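(* Let $\mathbb F$ be a field with $\mathrm{char}(\mathbb F)=0$ and let $n\ge 3$. Let $\mathfrak q=(q_{ij})$ be a multiplicatively antisymmetric $n\times n$ matrix with entries in $\mathbb F^\ast$ such that at most one of the entries $q_{ij}$ with $i<j$ is equal to $1$. Let $\mathcal O_{\mathfrak q}$ be the corresponding quantum affine space and let $E$ be the associated module of derivations defined in the context. Then: (1) If $q_{ij}\neq 1$ for all $i<j$, then $\mathrm{Aut}_{\mathbb F}(\mathcal O_{\mathfrak q})=(\mathbb F^\ast)^n$ if and only if both of the following hold: (a) $E=0$; and (b) there does not exist any non-identity permutation matrix $\mathfrak m_\sigma$ (where $\sigma\in S_n$) satisfying $\mathfrak q\,\mathfrak m_\sigma=\mathfrak m_\sigma\,\mathfrak q$. (2) If exactly one entry above the diagonal, say $q_{i'j'}$ with $i'<j'$, is equal to $1$, then $\mathrm{Aut}_{\mathbb F}(\mathcal O_{\mathfrak q})=(\mathbb F^\ast)^n$ if and only if both of the following hold: (a) $E=0$; and (b) there do not exist a permutation $\pi_1$ of the set $\{i',j'\}$ and a non-identity permutation $\pi_2$ of the set $\mathcal J=\{1,2,\dots,n\}\setminus\{i',j'\}$ satisfying $$q_{i'r}=q_{\pi_1(i')\pi_2(r)},\qquad q_{j'r}=q_{\pi_1(j')\pi_2(r)}\qquad\text{for all } r\in\mathcal J,$$ and such that $\mathfrak q'\,\mathfrak m_{\pi_2}=\mathfrak m_{\pi_2}\,\mathfrak q'$, where $\mathfrak q'$ is the multiplicatively antisymmetric matrix obtained from $\mathfrak q$ by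 removing the rows and columns with indices $i'$ and $j'$.
   Context: A matrix $\mathfrak q=(q_{ij})$ with entries in $\mathbb F^\ast=\mathbb F\setminus\{0\}$ is multiplicatively antisymmetric if $q_{ii}=1$ and $q_{ji}=q_{ij}^{-1}$ for all $i,j$. The quantum affine space $\mathcal O_{\mathfrak q}=\mathcal O_{\mathfrak q}(\mathbb F^n)$ is the quotient of the free associative $\mathbb F$-algebra $\mathbb F\{X_1,\dots,X_n\}$ by the two-sided ideal generated by the elements $X_iX_j-q_{ij}X_jX_i$ for $1\le i<j\le n$. $\mathrm{Aut}_{\mathbb F}(\mathcal O_{\mathfrak q})$ is the group of its $\mathbb F$-algebra automorphisms. The torus $(\mathbb F^\ast)^n$ is identified with the subgroup of scalar automorphisms $X_i\mapsto t_iX_i$, $t_i\in\mathbb F^\ast$; thus $\mathrm{Aut}_{\mathbb F}(\mathcal O_{\mathfrak q})=(\mathbb F^\ast)^n$ means that every automorphism is of this form. For a permutation $\sigma$, $\mathfrak m_\sigma$ denotes the corresponding permutation matrix. In part (2), the rows and columns of $\mathfrak q'$ and of $\mathfrak m_{\pi_2}$ are indexed by $\mathcal J$. Definition of $E$: with $\mathbb N$ the set of non-negative integers, for $1\le i\le n$ put $$\Lambda_i=\Bigl\{\nu=(\nu_1,\dots,\nu_n)\in\mathbb N^n:\ \nu_i=0\ \text{ and }\ \prod_{k}q_{kj}^{\nu_k}=q_{ij}\ \text{ for all } j\neq i\Bigr\}.$$ For $\nu\in\Lambda_i$ there is a derivation $D_{i\nu}$ of $\mathcal O_{\mathfrak q}$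 with $D_{i\nu}(X_j)=\delta_{ij}\mathbf X^{\nu}$ for all $j$, where $\mathbf X^\nu=X_1^{\nu_1}\cdots X_n^{\nu_n}$. One sets $E=\bigoplus_i\bigoplus_{\nu\in\Lambda_i}\mathcal O_{\mathfrak q}D_{i\nu}$. In particular $E=0$ means precisely that $\Lambda_i=\emptyset$ for every $i$. *)

theory Defs
  imports "HOL-Algebra.QuotRing" "HOL-Combinatorics.Permutations"
begin

text \<open>
  The free algebra in the variables \<open>X\<^sub>1, \<dots>, X\<^sub>n\<close> consists of the finitely supported functions
  on words in the letters \<open>1, \<dots>, n\<close>; the word \<open>[i\<^sub>1, \<dots>, i\<^sub>r]\<close> stands for the noncommutative
  monomial \<open>X\<^bsub>i\<^sub>1\<^esub> \<dots> X\<^bsub>i\<^sub>r\<^esub>\<close>, and the product is convolution.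
\<close>

definition free_algebra :: "nat \<Rightarrow> (nat list \<Rightarrow> 'a::field) ring" where
  "free_algebra n =
    \<lparr>carrier = {f. finite {w. f w \<noteq> 0} \<and> {w. f w \<noteq> 0} \<subseteq> lists {1..n}},
     monoid.mult = (\<lambda>f g w. \<Sum>(u, v)\<in>{(u, v). u @ v = w}. f u * g v),
     monoid.one = (\<lambda>w. if w = [] then 1 else 0),
     ring.zero = (\<lambda>w. 0),
     ring.add = (\<lambda>f g w. f w + g w)\<rparr>"

definition free_var :: "nat \<Rightarrow> nat list \<Rightarrow> 'a::field" where
  "free_var i = (\<lambda>w. if w = [i] then 1 else 0)"

definition free_const :: "'a::field \<Rightarrow> nat list \<Rightarrow> 'a" where
  "free_const c = (\<lambda>w. if w = [] then c else 0)"

lemma finite_splits: "finite {(u, v). u @ v = (w :: 'b list)}"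
proof (rule finite_subset)
  show "{(u, v). u @ v = w} \<subseteq> (\<lambda>i. (take i w, drop i w)) ` {..length w}"
  proof clarify
    fix u v assume "w = u @ v"
    then show "(u, v) \<in> (\<lambda>i. (take i (u @ v), drop i (u @ v))) ` {..length (u @ v)}"
      by (intro image_eqI [where x = "length u"]) auto
  qed
qed simp

lemma splits_assoc:
  fixes f g h :: "'b list \<Rightarrow> 'a::comm_ring_1"
  shows "(\<Sum>(u, v)\<in>{(u, v). u @ v = w}. (\<Sum>(s, t)\<in>{(s, t). s @ t = u}. f s * g t) * h v) =
         (\<Sum>(u, v)\<in>{(u, v). u @ v = w}. f u * (\<Sum>(s, t)\<in>{(s, t). s @ t = v}. g s * h t))"
    (is "?L = ?R")
proof -
  have "?L = (\<Sum>p\<in>{(u, v). u @ v = w}. \<Sum>r\<in>{(s, t). s @ t = fst p}.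
                f (fst r) * g (snd r) * h (snd p))"
    by (simp add: case_prod_beta sum_distrib_right)
  also have "\<dots> = (\<Sum>(p, r)\<in>Sigma {(u, v). u @ v = w} (\<lambda>p. {(s, t). s @ t = fst p}).
                f (fst r) * g (snd r) * h (snd p))"
    by (rule sum.Sigma) (auto intro: finite_splits)
  also have "\<dots> = (\<Sum>(p, r)\<in>Sigma {(u, v). u @ v = w} (\<lambda>p. {(s, t). s @ t = snd p}).
                f (fst p) * g (fst r) * h (snd r))"
    by (rule sum.reindex_bij_witness
          [where i = "\<lambda>((a, b), (c, d)). ((a @ c, d), (a, c))"
             and j = "\<lambda>((a, b), (c, d)). ((c, d @ b), (d, b))"]) auto
  also have "\<dots> = (\<Sum>p\<in>{(u, v). u @ v = w}. \<Sum>r\<in>{(s, t). s @ t = snd p}.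
                f (fst p) * g (fst r) * h (snd r))"
    by (rule sum.Sigma [symmetric]) (auto intro: finite_splits)
  also have "\<dots> = ?R"
    by (simp add: case_prod_beta sum_distrib_left mult.assoc)
  finally show ?thesis .
qed

lemma free_mult_closed:
  assumes "f \<in> carrier (free_algebra n)" "g \<in> carrier (free_algebra n)"
  shows "f \<otimes>\<^bsub>free_algebra n\<^esub> g \<in> carrier (free_algebra n)"
proof -
  let ?h = "f \<otimes>\<^bsub>free_algebra n\<^esub> g"
  have *: "{w. ?h w \<noteq> 0} \<subseteq> (\<lambda>(u, v). u @ v) ` ({w. f w \<noteq> 0} \<times> {w. g w \<noteq> 0})"
  proof
    fix w assume "w \<in> {w. ?h w \<noteq> 0}"
    then have "(\<Sum>(u, v)\<in>{(u, v). u @ v = w}. f u * g v) \<noteq> 0"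
      by (simp add: free_algebra_def)
    then obtain p where "p \<in> {(u, v). u @ v = w}" "(case p of (u, v) \<Rightarrow> f u * g v) \<noteq> 0"
      by (meson sum.not_neutral_contains_not_neutral)
    then show "w \<in> (\<lambda>(u, v). u @ v) ` ({w. f w \<noteq> 0} \<times> {w. g w \<noteq> 0})"
      by force
  qed
  have "finite {w. f w \<noteq> 0}" "finite {w. g w \<noteq> 0}"
    "{w. f w \<noteq> 0} \<subseteq> lists {1..n}" "{w. g w \<noteq> 0} \<subseteq> lists {1..n}"
    using assms by (auto simp: free_algebra_def)
  then have "finite {w. ?h w \<noteq> 0}" "{w. ?h w \<noteq> 0} \<subseteq> lists {1..n}"
    using finite_subset [OF *] * by (simp, fastforce)
  then show ?thesis
    by (simp add: free_algebra_def)
qed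

lemma free_algebra_ring: "ring (free_algebra n :: (nat list \<Rightarrow> 'a::field) ring)" (is "ring ?R")
proof (rule ringI)
  show "abelian_group ?R"
  proof (rule abelian_groupI)
    fix f g :: "nat list \<Rightarrow> 'a"
    assume "f \<in> carrier ?R" "g \<in> carrier ?R"
    moreover have "{w. f w + g w \<noteq> 0} \<subseteq> {w. f w \<noteq> 0} \<union> {w. g w \<noteq> 0}" by auto
    ultimately show "f \<oplus>\<^bsub>?R\<^esub> g \<in> carrier ?R"
      unfolding free_algebra_def
      by (auto intro: finite_subset [of _ "{w. f w \<noteq> 0} \<union> {w. g w \<noteq> 0}"])
  next
    fix f :: "nat list \<Rightarrow> 'a" assume "f \<in> carrier ?R"
    then show "\<exists>g\<in>carrier ?R. g \<oplus>\<^bsub>?R\<^esub> f = \<zero>\<^bsub>?R\<^esub>"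
      by (intro bexI [of _ "\<lambda>w. - f w"]) (auto simp: free_algebra_def)
  qed (auto simp: free_algebra_def algebra_simps)
  show "monoid ?R"
  proof (rule monoidI)
    fix f g h :: "nat list \<Rightarrow> 'a"
    show "f \<otimes>\<^bsub>?R\<^esub> g \<otimes>\<^bsub>?R\<^esub> h = f \<otimes>\<^bsub>?R\<^esub> (g \<otimes>\<^bsub>?R\<^esub> h)"
      using splits_assoc [of f g h] by (simp add: free_algebra_def)
  next
    fix f :: "nat list \<Rightarrow> 'a"
    have "(\<Sum>(u, v)\<in>{(u, v). u @ v = w}. (if u = [] then 1 else 0) * f v) = f w" for w
    proof -
      have "(\<Sum>(u, v)\<in>{(u, v). u @ v = w}. (if u = [] then 1 else 0) * f v) =
            (\<Sum>(u, v)\<in>{([] :: nat list, w)}. (if u = [] then 1 else 0) * f v)"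
        by (rule sum.mono_neutral_right [OF finite_splits]) (auto split: if_splits)
      then show ?thesis by simp
    qed
    then show "\<one>\<^bsub>?R\<^esub> \<otimes>\<^bsub>?R\<^esub> f = f" by (simp add: free_algebra_def)
    have "(\<Sum>(u, v)\<in>{(u, v). u @ v = w}. f u * (if v = [] then 1 else 0)) = f w" for w
    proof -
      have "(\<Sum>(u, v)\<in>{(u, v). u @ v = w}. f u * (if v = [] then 1 else 0)) =
            (\<Sum>(u, v)\<in>{(w, [] :: nat list)}. f u * (if v = [] then 1 else 0))"
        by (rule sum.mono_neutral_right [OF finite_splits]) (auto split: if_splits)
      then show ?thesis by simp
    qed
    then show "f \<otimes>\<^bsub>?R\<^esub> \<one>\<^bsub>?R\<^esub> = f" by (simp add: free_algebra_def)
  next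
    have "{w. (if w = [] then 1 else 0) \<noteq> (0::'a)} = {[] :: nat list}" by auto
    then show "\<one>\<^bsub>?R\<^esub> \<in> carrier ?R" by (simp add: free_algebra_def)
  qed (rule free_mult_closed)
qed (auto simp: free_algebra_def case_prod_beta distrib_left distrib_right sum.distrib)

lemma free_var_closed: "i \<in> {1..n} \<Longrightarrow> free_var i \<in> carrier (free_algebra n)"
proof -
  assume "i \<in> {1..n}"
  moreover have "{w. free_var i w \<noteq> (0::'a)} = {[i]}" by (auto simp: free_var_def)
  ultimately show ?thesis by (simp add: free_algebra_def)
qed

lemma free_const_closed: "free_const c \<in> carrier (free_algebra n)"
proof -
  have "{w. free_const c w \<noteq> 0} \<subseteq> {[]}" by (auto simp: free_const_def)
  then show ?thesis by (auto simp: free_algebra_def intro: finite_subset)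
qed

definition mult_antisym :: "nat \<Rightarrow> (nat \<Rightarrow> nat \<Rightarrow> 'a::field) \<Rightarrow> bool" where
  "mult_antisym n q \<longleftrightarrow>
    (\<forall>i\<in>{1..n}. \<forall>j\<in>{1..n}. q i j \<noteq> 0 \<and> q i i = 1 \<and> q j i = inverse (q i j))"

definition q_relations :: "nat \<Rightarrow> (nat \<Rightarrow> nat \<Rightarrow> 'a::field) \<Rightarrow> (nat list \<Rightarrow> 'a) set" where
  "q_relations n q =
    {free_var i \<otimes>\<^bsub>free_algebra n\<^esub> free_var j \<ominus>\<^bsub>free_algebra n\<^esub>
       free_const (q i j) \<otimes>\<^bsub>free_algebra n\<^esub> (free_var j \<otimes>\<^bsub>free_algebra n\<^esub> free_var i)
     | i j. 1 \<le> i \<and> i < j \<and> j \<le> n}"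

definition q_ideal :: "nat \<Rightarrow> (nat \<Rightarrow> nat \<Rightarrow> 'a::field) \<Rightarrow> (nat list \<Rightarrow> 'a) set" where
  "q_ideal n q = Idl\<^bsub>free_algebra n\<^esub> (q_relations n q)"

definition q_space :: "nat \<Rightarrow> (nat \<Rightarrow> nat \<Rightarrow> 'a::field) \<Rightarrow> (nat list \<Rightarrow> 'a) set ring" where
  "q_space n q = free_algebra n Quot q_ideal n q"

lemma q_ideal_ideal: "ideal (q_ideal n q) (free_algebra n)"
proof -
  interpret ring "free_algebra n :: (nat list \<Rightarrow> 'a) ring" by (rule free_algebra_ring)
  show ?thesis
    unfolding q_ideal_def
    by (rule genideal_ideal)
       (auto simp: q_relations_def intro!: minus_closed m_closed free_var_closed free_const_closed)
qed

lemma q_space_ring: "ring (q_space n q)"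
  unfolding q_space_def by (rule ideal.quotient_is_ring [OF q_ideal_ideal])

definition q_var :: "nat \<Rightarrow> (nat \<Rightarrow> nat \<Rightarrow> 'a::field) \<Rightarrow> nat \<Rightarrow> (nat list \<Rightarrow> 'a) set" where
  "q_var n q i = q_ideal n q +>\<^bsub>free_algebra n\<^esub> free_var i"

definition q_scale ::
    "nat \<Rightarrow> (nat \<Rightarrow> nat \<Rightarrow> 'a::field) \<Rightarrow> 'a \<Rightarrow> (nat list \<Rightarrow> 'a) set \<Rightarrow> (nat list \<Rightarrow> 'a) set" where
  "q_scale n q c x = (q_ideal n q +>\<^bsub>free_algebra n\<^esub> free_const c) \<otimes>\<^bsub>q_space n q\<^esub> x"

text \<open>\<open>X\<^sub>1\<^bsup>\<nu>\<^sub>1\<^esup> \<dots> X\<^sub>n\<^bsup>\<nu>\<^sub>n\<^esup>\<close>, the factors in increasing order of the index\<close>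

definition q_monom ::
    "nat \<Rightarrow> (nat \<Rightarrow> nat \<Rightarrow> 'a::field) \<Rightarrow> (nat \<Rightarrow> nat) \<Rightarrow> (nat list \<Rightarrow> 'a) set" where
  "q_monom n q \<nu> =
    foldr (\<lambda>k m. (q_var n q k [^]\<^bsub>q_space n q\<^esub> \<nu> k) \<otimes>\<^bsub>q_space n q\<^esub> m) [1..<Suc n] \<one>\<^bsub>q_space n q\<^esub>"

text \<open>
  Maps on the carrier are taken extensional (\<open>undefined\<close> outside), so that equality of HOL
  functions is equality of maps on the algebra.
\<close>

definition q_Aut ::
    "nat \<Rightarrow> (nat \<Rightarrow> nat \<Rightarrow> 'a::field) \<Rightarrow> ((nat list \<Rightarrow> 'a) set \<Rightarrow> (nat list \<Rightarrow> 'a) set) set" where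
  "q_Aut n q =
    {\<phi> \<in> ring_iso (q_space n q) (q_space n q) \<inter> extensional (carrier (q_space n q)).
       \<forall>c. \<forall>x\<in>carrier (q_space n q). \<phi> (q_scale n q c x) = q_scale n q c (\<phi> x)}"

definition q_torus ::
    "nat \<Rightarrow> (nat \<Rightarrow> nat \<Rightarrow> 'a::field) \<Rightarrow> ((nat list \<Rightarrow> 'a) set \<Rightarrow> (nat list \<Rightarrow> 'a) set) set" where
  "q_torus n q =
    {\<phi> \<in> q_Aut n q. \<exists>t. \<forall>i\<in>{1..n}. t i \<noteq> 0 \<and> \<phi> (q_var n q i) = q_scale n q (t i) (q_var n q i)}"

definition q_derivations ::
    "nat \<Rightarrow> (nat \<Rightarrow> nat \<Rightarrow> 'a::field) \<Rightarrow> ((nat list \<Rightarrow> 'a) set \<Rightarrow> (nat list \<Rightarrow> 'a) set) set" where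
  "q_derivations n q =
    {D \<in> carrier (q_space n q) \<rightarrow>\<^sub>E carrier (q_space n q).
       (\<forall>x\<in>carrier (q_space n q). \<forall>y\<in>carrier (q_space n q).
          D (x \<oplus>\<^bsub>q_space n q\<^esub> y) = D x \<oplus>\<^bsub>q_space n q\<^esub> D y \<and>
          D (x \<otimes>\<^bsub>q_space n q\<^esub> y) =
            D x \<otimes>\<^bsub>q_space n q\<^esub> y \<oplus>\<^bsub>q_space n q\<^esub> x \<otimes>\<^bsub>q_space n q\<^esub> D y) \<and>
       (\<forall>c. \<forall>x\<in>carrier (q_space n q). D (q_scale n q c x) = q_scale n q c (D x))}"

text \<open>An element of \<open>\<nat>\<^sup>n\<close> is a function on \<open>nat\<close> that vanishes outside \<open>{1..n}\<close>.\<close>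

definition Lambda :: "nat \<Rightarrow> (nat \<Rightarrow> nat \<Rightarrow> 'a::field) \<Rightarrow> nat \<Rightarrow> (nat \<Rightarrow> nat) set" where
  "Lambda n q i =
    {\<nu>. (\<forall>k. k \<notin> {1..n} \<longrightarrow> \<nu> k = 0) \<and> \<nu> i = 0 \<and>
        (\<forall>j\<in>{1..n} - {i}. (\<Prod>k\<in>{1..n}. q k j ^ \<nu> k) = q i j)}"

text \<open>
  The description determines a derivation uniquely, since the variables generate the algebra;
  for \<open>\<nu> \<in> \<Lambda>\<^sub>i\<close> it exists.
\<close>

definition q_D ::
    "nat \<Rightarrow> (nat \<Rightarrow> nat \<Rightarrow> 'a::field) \<Rightarrow> nat \<Rightarrow> (nat \<Rightarrow> nat) \<Rightarrow>
      (nat list \<Rightarrow> 'a) set \<Rightarrow> (nat list \<Rightarrow> 'a) set" where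
  "q_D n q i \<nu> =
    (THE D. D \<in> q_derivations n q \<and>
       (\<forall>j\<in>{1..n}. D (q_var n q j) = (if j = i then q_monom n q \<nu> else \<zero>\<^bsub>q_space n q\<^esub>)))"

text \<open>
  The sum of the left submodules \<open>\<O>\<^sub>q D\<^sub>i\<^sub>\<nu>\<close>, formed among the maps from the algebra to itself:
  all finite sums of maps \<open>x \<mapsto> a \<cdot> D\<^sub>i\<^sub>\<nu>(x)\<close>.
\<close>

definition q_E ::
    "nat \<Rightarrow> (nat \<Rightarrow> nat \<Rightarrow> 'a::field) \<Rightarrow> ((nat list \<Rightarrow> 'a) set \<Rightarrow> (nat list \<Rightarrow> 'a) set) set" where
  "q_E n q =
    {(\<lambda>x\<in>carrier (q_space n q).
        finsum (q_space n q) (\<lambda>(i, \<nu>). a i \<nu> \<otimes>\<^bsub>q_space n q\<^esub> q_D n q i \<nu> x) S)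
     | a S. finite S \<and> S \<subseteq> Sigma {1..n} (Lambda n q) \<and>
            (\<forall>(i, \<nu>)\<in>S. a i \<nu> \<in> carrier (q_space n q))}"

definition q_zero_map ::
    "nat \<Rightarrow> (nat \<Rightarrow> nat \<Rightarrow> 'a::field) \<Rightarrow> (nat list \<Rightarrow> 'a) set \<Rightarrow> (nat list \<Rightarrow> 'a) set" where
  "q_zero_map n q = (\<lambda>x\<in>carrier (q_space n q). \<zero>\<^bsub>q_space n q\<^esub>)"

text \<open>
  A matrix with rows and columns indexed by \<open>I\<close> is a binary function of which only the entries
  in \<open>I \<times> I\<close> matter. In particular, removing rows and columns amounts to shrinking the index set.
\<close>

definition mat_mult_on ::
    "nat set \<Rightarrow> (nat \<Rightarrow> nat \<Rightarrow> 'a::field) \<Rightarrow> (nat \<Rightarrow> nat \<Rightarrow> 'a) \<Rightarrow> nat \<Rightarrow> nat \<Rightarrow> 'a" where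
  "mat_mult_on I A B = (\<lambda>i j. \<Sum>k\<in>I. A i k * B k j)"

definition mat_commute_on ::
    "nat set \<Rightarrow> (nat \<Rightarrow> nat \<Rightarrow> 'a::field) \<Rightarrow> (nat \<Rightarrow> nat \<Rightarrow> 'a) \<Rightarrow> bool" where
  "mat_commute_on I A B \<longleftrightarrow> (\<forall>i\<in>I. \<forall>j\<in>I. mat_mult_on I A B i j = mat_mult_on I B A i j)"

definition perm_matrix :: "(nat \<Rightarrow> nat) \<Rightarrow> nat \<Rightarrow> nat \<Rightarrow> 'a::field" where
  "perm_matrix \<sigma> = (\<lambda>i j. if i = \<sigma> j then 1 else 0)"

definition unit_entries :: "nat \<Rightarrow> (nat \<Rightarrow> nat \<Rightarrow> 'a::field) \<Rightarrow> (nat \<times> nat) set" where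
  "unit_entries n q = {(i, j). 1 \<le> i \<and> i < j \<and> j \<le> n \<and> q i j = 1}"

end

theory Submission
  imports Defs "HOL-Library.Multiset_Order"
begin

text \<open>
  The heart of the proof is \<open>Aut_eq_torus_iff\<close>: every automorphism of \<open>\<O>\<^sub>q\<close> is scalar if and only
  if all sets \<open>\<Lambda>\<^sub>i\<close> are empty and no permutation \<open>\<sigma> \<noteq> id\<close> satisfies \<open>q\<^bsub>\<sigma>i \<sigma>j\<^esub> = q\<^bsub>ij\<^esub>\<close> throughout.

  Both conditions are necessary because their failure produces automorphisms. A symmetry \<open>\<sigma>\<close> of the
  matrix permutes the variables (\<open>permutation_Aut\<close>). For \<open>\<nu> \<in> \<Lambda>\<^sub>i\<close> the monomial \<open>X\<^sup>\<nu>\<close> commutes with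
  the other variables in the same way as \<open>X\<^sub>i\<close> does, so \<open>X\<^sub>i \<mapsto> X\<^sub>i + X\<^sup>\<nu>\<close> respects the relations; its
  inverse is \<open>X\<^sub>i \<mapsto> X\<^sub>i - X\<^sup>\<nu>\<close>, since \<open>X\<^sup>\<nu>\<close> does not involve \<open>X\<^sub>i\<close> and stays fixed (\<open>shear_Aut\<close>).

  Conversely, let all \<open>\<Lambda>\<^sub>i\<close> be empty, let \<open>\<phi>\<close> be an automorphism and \<open>\<psi>\<close> its inverse. A variable is
  a normal element, hence so is each \<open>f = \<psi>(X\<^sub>i)\<close>: it satisfies \<open>f X\<^sub>j = h f\<close> for some \<open>h\<close>. Comparing
  the greatest and the least monomials of both sides in a total order of the monomials forces \<open>h\<close>
  to be a multiple of \<open>X\<^sub>j\<close> (\<open>normal_skew\<close>), so all monomials of \<open>f\<close> commute with \<open>X\<^sub>j\<close> up to the same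
  scalar (\<open>skew_support\<close>). If \<open>X\<^sub>a\<close> is one of these monomials, then each of them is divisible by \<open>X\<^sub>a\<close>,
  because the exponent of any other one would lie in \<open>\<Lambda>\<^sub>a\<close> (\<open>Lambda_count\<close>). Hence \<open>f = X\<^sub>a z\<close>, and
  \<open>X\<^sub>i = \<phi>(X\<^sub>a) \<phi>(z)\<close>; comparing greatest monomials once more, \<open>\<phi>(X\<^sub>a)\<close> is a multiple of \<open>X\<^sub>i\<close>
  (\<open>Aut_monomial\<close>). Every \<open>a\<close> is reached in this way, as \<open>\<psi>\<close> is onto (\<open>Aut_linear_part\<close>). So \<open>\<phi>\<close> permutes
  the variables up to scalars, by a symmetry of the matrix (\<open>Aut_permutation\<close>).

  All this rests on the fact that the ordered monomials form a basis of \<open>\<O>\<^sub>q\<close>; the sections up to the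
  one on coordinates establish it, together with the universal property of \<open>\<O>\<^sub>q\<close> from which
  automorphisms and derivations are obtained.

  The theorem follows. The module \<open>E\<close> vanishes exactly if all \<open>\<Lambda>\<^sub>i\<close> are empty (\<open>E_zero_iff\<close>), and
  commuting with the permutation matrix of \<open>\<sigma>\<close> means \<open>q\<^bsub>\<sigma>i \<sigma>j\<^esub> = q\<^bsub>ij\<^esub>\<close>. If exactly one pair of variables
  commutes, then a symmetry preserves that pair and so splits into \<open>\<pi>\<^sub>1\<close> and \<open>\<pi>\<^sub>2\<close>; if \<open>\<pi>\<^sub>2\<close> were the
  identity, it would exchange the two variables, which would then obey the same relations and give
  an element of \<open>\<Lambda>\<^bsub>i'\<^esub>\<close> (\<open>symmetry_of_pair_iff\<close>).
\<close>

section \<open>Words in the free algebra\<close>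

definition free_word :: "'a::field \<Rightarrow> nat list \<Rightarrow> nat list \<Rightarrow> 'a" where
  "free_word c w = (\<lambda>v. if v = w then c else 0)"

lemma free_var_word: "free_var i = free_word 1 [i]"
  by (simp add: free_var_def free_word_def)

lemma free_const_word: "free_const c = free_word c []"
  by (simp add: free_const_def free_word_def)

lemma free_word_closed: "w \<in> lists {1..n} \<Longrightarrow> free_word c w \<in> carrier (free_algebra n)"
proof -
  assume "w \<in> lists {1..n}"
  moreover have "{v. free_word c w v \<noteq> 0} \<subseteq> {w}" by (auto simp: free_word_def)
  ultimately show ?thesis by (auto simp: free_algebra_def intro: finite_subset)
qed

lemma free_add: "f \<oplus>\<^bsub>free_algebra n\<^esub> g = (\<lambda>w. f w + g w)"
  by (simp add: free_algebra_def)

lemma free_zero: "\<zero>\<^bsub>free_algebra n\<^esub> = (\<lambda>w. 0)"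
  by (simp add: free_algebra_def)

lemma free_one: "\<one>\<^bsub>free_algebra n\<^esub> = free_word 1 []"
  by (simp add: free_algebra_def free_word_def)

lemma free_mult: "f \<otimes>\<^bsub>free_algebra n\<^esub> g = (\<lambda>w. \<Sum>(u, v)\<in>{(u, v). u @ v = w}. f u * g v)"
  by (simp add: free_algebra_def)

lemma free_word_mult:
  "free_word c u \<otimes>\<^bsub>free_algebra n\<^esub> free_word d v = free_word (c * d) (u @ v)"
proof
  fix w
  have "(\<Sum>(a, b)\<in>{(a, b). a @ b = w}. free_word c u a * free_word d v b) =
        (\<Sum>p\<in>{(a, b). a @ b = w}. if p = (u, v) then c * d else 0)"
    by (rule sum.cong) (auto simp: free_word_def split: if_splits)
  also have "\<dots> = free_word (c * d) (u @ v) w"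
    by (auto simp: finite_splits sum.delta free_word_def)
  finally show "(free_word c u \<otimes>\<^bsub>free_algebra n\<^esub> free_word d v) w = free_word (c * d) (u @ v) w"
    by (simp add: free_mult)
qed

lemma free_minus:
  assumes "f \<in> carrier (free_algebra n)" "g \<in> carrier (free_algebra n)"
  shows "f \<ominus>\<^bsub>free_algebra n\<^esub> g = (\<lambda>w. f w - g w)"
proof -
  interpret F: ring "free_algebra n :: (nat list \<Rightarrow> 'a) ring" by (rule free_algebra_ring)
  have "(\<lambda>w. - g w) \<in> carrier (free_algebra n)"
    using assms(2) by (simp add: free_algebra_def)
  then have "\<ominus>\<^bsub>free_algebra n\<^esub> g = (\<lambda>w. - g w)"
    using assms(2) by (intro F.minus_equality) (auto simp: free_add free_zero)
  then show ?thesis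
    by (simp add: a_minus_def free_add)
qed

text \<open>
  Additive statements about the free algebra need only be checked on scalar multiples of words.
\<close>

lemma free_induct [consumes 1, case_names word add]:
  assumes "f \<in> carrier (free_algebra n)"
    and word: "\<And>c w. w \<in> lists {1..n} \<Longrightarrow> P (free_word c w)"
    and add: "\<And>f g. f \<in> carrier (free_algebra n) \<Longrightarrow> g \<in> carrier (free_algebra n) \<Longrightarrow>
                 P f \<Longrightarrow> P g \<Longrightarrow> P (f \<oplus>\<^bsub>free_algebra n\<^esub> g)"
  shows "P f"
proof -
  have "P f" if "finite S" "S \<subseteq> lists {1..n}" "{w. f w \<noteq> 0} \<subseteq> S" for S f
    using that
  proof (induction S arbitrary: f rule: finite_induct)
    case empty
    then have "f = free_word 0 []" by (auto simp: free_word_def)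
    then show ?case using word [of "[]" 0] by simp
  next
    case (insert w S)
    define g where "g = f(w := 0)"
    have g: "{v. g v \<noteq> 0} \<subseteq> S" using insert by (auto simp: g_def)
    with insert have "P g" by auto
    moreover have "g \<in> carrier (free_algebra n)"
      using g insert by (auto simp: free_algebra_def intro: finite_subset)
    moreover have "f = free_word (f w) w \<oplus>\<^bsub>free_algebra n\<^esub> g"
      by (auto simp: free_add free_word_def g_def)
    ultimately show ?case
      using add [of "free_word (f w) w" g] word [of w "f w"] free_word_closed insert by auto
  qed
  then show ?thesis using assms(1) by (auto simp: free_algebra_def)
qed

section \<open>Evaluation of noncommutative polynomials\<close>

text \<open>
  An algebra over a field, with the scalars given as central elements. The same notion serves for
  quantum affine space and for the dual numbers over it.
\<close>

locale scalar_algebra = ring B for B :: "('b, 'm) ring_scheme" (structure) +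
  fixes scal :: "'a::field \<Rightarrow> 'b"
  assumes scal_closed [simp, intro]: "scal c \<in> carrier B"
    and scal_one [simp]: "scal 1 = \<one>"
    and scal_add: "scal (c + d) = scal c \<oplus> scal d"
    and scal_mult: "scal (c * d) = scal c \<otimes> scal d"
    and scal_central: "x \<in> carrier B \<Longrightarrow> x \<otimes> scal c = scal c \<otimes> x"
begin

lemma scal_zero [simp]: "scal 0 = \<zero>"
proof -
  have "scal 0 \<oplus> scal 0 = scal 0" using scal_add [of 0 0] by simp
  then show ?thesis by (simp add: add.l_cancel_one)
qed

lemma scal_minus: "scal (- c) = \<ominus> scal c"
  using scal_add [of "- c" c] by (intro minus_equality [symmetric]) auto

lemma scal_left_commute:
  "x \<in> carrier B \<Longrightarrow> y \<in> carrier B \<Longrightarrow> x \<otimes> (scal c \<otimes> y) = scal c \<otimes> (x \<otimes> y)"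
  using m_assoc [of x "scal c" y] m_assoc [of "scal c" x y] scal_central [of x c] by simp

lemma scal_scal: "x \<in> carrier B \<Longrightarrow> scal c \<otimes> (scal d \<otimes> x) = scal (c * d) \<otimes> x"
  by (simp add: scal_mult m_assoc)

lemma scal_prod:
  assumes "x \<in> carrier B" "y \<in> carrier B"
  shows "(scal c \<otimes> x) \<otimes> (scal d \<otimes> y) = scal (c * d) \<otimes> (x \<otimes> y)"
proof -
  have "(scal c \<otimes> x) \<otimes> (scal d \<otimes> y) = scal c \<otimes> (x \<otimes> (scal d \<otimes> y))"
    using assms by (simp add: m_assoc)
  also have "x \<otimes> (scal d \<otimes> y) = scal d \<otimes> (x \<otimes> y)"
    using assms by (rule scal_left_commute)
  finally show ?thesis using assms by (simp add: scal_scal)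
qed

definition word_value :: "(nat \<Rightarrow> 'b) \<Rightarrow> nat list \<Rightarrow> 'b" where
  "word_value b w = foldr (\<lambda>i x. b i \<otimes> x) w \<one>"

definition free_value :: "(nat \<Rightarrow> 'b) \<Rightarrow> (nat list \<Rightarrow> 'a) \<Rightarrow> 'b" where
  "free_value b f = (\<Oplus>w\<in>{w. f w \<noteq> 0}. scal (f w) \<otimes> word_value b w)"

lemma word_value_Nil [simp]: "word_value b [] = \<one>"
  by (simp add: word_value_def)

lemma word_value_Cons [simp]: "word_value b (i # w) = b i \<otimes> word_value b w"
  by (simp add: word_value_def)

lemma word_value_closed:
  "b \<in> {1..n} \<rightarrow> carrier B \<Longrightarrow> w \<in> lists {1..n} \<Longrightarrow> word_value b w \<in> carrier B"
  by (induction w) auto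

lemma word_value_append:
  "b \<in> {1..n} \<rightarrow> carrier B \<Longrightarrow> u \<in> lists {1..n} \<Longrightarrow> v \<in> lists {1..n} \<Longrightarrow>
     word_value b (u @ v) = word_value b u \<otimes> word_value b v"
proof (induction u)
  case Nil
  then show ?case by (simp add: word_value_closed)
next
  case (Cons a u)
  then show ?case
    using word_value_closed [of b n u] word_value_closed [of b n v]
    by (auto simp: m_assoc Pi_iff)
qed

lemma free_value_term_closed:
  "b \<in> {1..n} \<rightarrow> carrier B \<Longrightarrow> S \<subseteq> lists {1..n} \<Longrightarrow> w \<in> S \<Longrightarrow>
     scal (f w) \<otimes> word_value b w \<in> carrier B"
  using word_value_closed [of b n w] by blast

text \<open>
  Evaluation sums over the support, which differs between \<open>f\<close>, \<open>g\<close> and \<open>f + g\<close>; a common finite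
  superset makes the sums comparable.
\<close>

lemma free_value_superset:
  assumes "b \<in> {1..n} \<rightarrow> carrier B" "finite S" "S \<subseteq> lists {1..n}" "{w. f w \<noteq> 0} \<subseteq> S"
  shows "free_value b f = (\<Oplus>w\<in>S. scal (f w) \<otimes> word_value b w)"
  unfolding free_value_def
proof (rule add.finprod_mono_neutral_cong_left)
  fix w assume w: "w \<in> S - {w. f w \<noteq> 0}"
  then have "word_value b w \<in> carrier B"
    using assms word_value_closed [of b n w] by blast
  then show "scal (f w) \<otimes> word_value b w = \<zero>" using w by simp
qed (use assms free_value_term_closed [OF assms(1) assms(3)] in auto)

lemma free_value_closed:
  assumes "b \<in> {1..n} \<rightarrow> carrier B" "f \<in> carrier (free_algebra n)"
  shows "free_value b f \<in> carrier B"
proof -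
  have "{w. f w \<noteq> 0} \<subseteq> lists {1..n}"
    using assms(2) by (simp add: free_algebra_def)
  then show ?thesis
    unfolding free_value_def
    by (intro finsum_closed funcsetI) (rule free_value_term_closed [OF assms(1)])
qed

lemma free_value_word:
  assumes "b \<in> {1..n} \<rightarrow> carrier B" "w \<in> lists {1..n}"
  shows "free_value b (free_word c w) = scal c \<otimes> word_value b w"
proof -
  have "free_value b (free_word c w) = (\<Oplus>v\<in>{w}. scal (free_word c w v) \<otimes> word_value b v)"
    by (rule free_value_superset) (use assms in \<open>auto simp: free_word_def\<close>)
  also have "\<dots> = scal c \<otimes> word_value b w"
    using word_value_closed [OF assms] by (simp add: free_word_def)
  finally show ?thesis .
qed

lemma free_value_add:
  assumes b: "b \<in> {1..n} \<rightarrow> carrier B"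
    and f: "f \<in> carrier (free_algebra n)" and g: "g \<in> carrier (free_algebra n)"
  shows "free_value b (f \<oplus>\<^bsub>free_algebra n\<^esub> g) = free_value b f \<oplus> free_value b g"
proof -
  let ?S = "{w. f w \<noteq> 0} \<union> {w. g w \<noteq> 0}"
  have S: "finite ?S" "?S \<subseteq> lists {1..n}" using f g by (auto simp: free_algebra_def)
  have val: "word_value b w \<in> carrier B" if "w \<in> ?S" for w
    using S word_value_closed [OF b] that by blast
  have "free_value b (f \<oplus>\<^bsub>free_algebra n\<^esub> g) = (\<Oplus>w\<in>?S. scal (f w + g w) \<otimes> word_value b w)"
    unfolding free_add by (rule free_value_superset [OF b S]) auto
  also have "\<dots> = (\<Oplus>w\<in>?S. scal (f w) \<otimes> word_value b w \<oplus> scal (g w) \<otimes> word_value b w)"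
    by (rule finsum_cong') (use val in \<open>auto simp: scal_add l_distr\<close>)
  also have "\<dots> = (\<Oplus>w\<in>?S. scal (f w) \<otimes> word_value b w) \<oplus> (\<Oplus>w\<in>?S. scal (g w) \<otimes> word_value b w)"
    by (rule finsum_addf) (use val in auto)
  also have "\<dots> = free_value b f \<oplus> free_value b g"
    using free_value_superset [OF b S, of f] free_value_superset [OF b S, of g] by auto
  finally show ?thesis .
qed

text \<open>
  Both sides are additive in each argument, so two words suffice, and there it is the compatibility
  with concatenation.
\<close>

lemma free_value_mult:
  assumes b: "b \<in> {1..n} \<rightarrow> carrier B"
    and f: "f \<in> carrier (free_algebra n)" and g: "g \<in> carrier (free_algebra n)"
  shows "free_value b (f \<otimes>\<^bsub>free_algebra n\<^esub> g) = free_value b f \<otimes> free_value b g"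
proof -
  interpret F: ring "free_algebra n :: (nat list \<Rightarrow> 'a) ring" by (rule free_algebra_ring)
  note closed = free_value_closed [OF b] and add = free_value_add [OF b]
  have mult_word: "free_value b (free_word c u \<otimes>\<^bsub>free_algebra n\<^esub> g) =
      free_value b (free_word c u) \<otimes> free_value b g" if u: "u \<in> lists {1..n}" for c u
    using g
  proof (induction g rule: free_induct)
    case (word d v)
    have "word_value b u \<in> carrier B" "word_value b v \<in> carrier B"
      using word_value_closed [OF b] word u by auto
    then show ?case
      using word u
      by (simp add: free_word_mult free_value_word [OF b] word_value_append [OF b] scal_prod)
  next
    case (add h k)
    then show ?case
      using free_word_closed [OF u, of c]
      by (simp add: F.r_distr free_value_add [OF b] closed r_distr)
  qed
  show ?thesis
    using f
  proof (induction f rule: free_induct)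
    case (word c w)
    then show ?case by (rule mult_word)
  next
    case (add h k)
    then show ?case
      using g by (simp add: F.l_distr free_value_add [OF b] closed l_distr)
  qed
qed

lemma free_value_hom:
  assumes "b \<in> {1..n} \<rightarrow> carrier B"
  shows "free_value b \<in> ring_hom (free_algebra n) B"
proof (rule ring_hom_memI)
  show "free_value b \<one>\<^bsub>free_algebra n\<^esub> = \<one>"
    by (simp add: free_one free_value_word [OF assms])
qed (use free_value_closed [OF assms] free_value_mult [OF assms] free_value_add [OF assms] in auto)

end

section \<open>The universal property of quantum affine space\<close>

definition q_class :: "nat \<Rightarrow> (nat \<Rightarrow> nat \<Rightarrow> 'a::field) \<Rightarrow> (nat list \<Rightarrow> 'a) \<Rightarrow> (nat list \<Rightarrow> 'a) set" where
  "q_class n q f = q_ideal n q +>\<^bsub>free_algebra n\<^esub> f"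

definition q_const :: "nat \<Rightarrow> (nat \<Rightarrow> nat \<Rightarrow> 'a::field) \<Rightarrow> 'a \<Rightarrow> (nat list \<Rightarrow> 'a) set" where
  "q_const n q c = q_class n q (free_const c)"

text \<open>
  Maps on the quotient are defined through a chosen representative of each class.
\<close>

definition q_rep :: "(nat list \<Rightarrow> 'a) set \<Rightarrow> nat list \<Rightarrow> 'a" where
  "q_rep x = (SOME f. f \<in> x)"

lemma q_var_class: "q_var n q i = q_class n q (free_var i)"
  by (simp add: q_var_def q_class_def)

lemma q_scale_const: "q_scale n q c x = q_const n q c \<otimes>\<^bsub>q_space n q\<^esub> x"
  by (simp add: q_scale_def q_const_def q_class_def)

lemma q_space_carrier: "carrier (q_space n q) = q_class n q ` carrier (free_algebra n)"
  by (auto simp: q_space_def FactRing_def A_RCOSETS_def' q_class_def)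

lemma q_class_hom: "q_class n q \<in> ring_hom (free_algebra n) (q_space n q)"
  using ideal.rcos_ring_hom [OF q_ideal_ideal, of n q]
  by (simp add: q_space_def q_class_def [abs_def])

lemma q_class_add:
  "f \<in> carrier (free_algebra n) \<Longrightarrow> g \<in> carrier (free_algebra n) \<Longrightarrow>
     q_class n q (f \<oplus>\<^bsub>free_algebra n\<^esub> g) = q_class n q f \<oplus>\<^bsub>q_space n q\<^esub> q_class n q g"
  by (rule ring_hom_add [OF q_class_hom])

lemma q_class_mult:
  "f \<in> carrier (free_algebra n) \<Longrightarrow> g \<in> carrier (free_algebra n) \<Longrightarrow>
     q_class n q (f \<otimes>\<^bsub>free_algebra n\<^esub> g) = q_class n q f \<otimes>\<^bsub>q_space n q\<^esub> q_class n q g"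
  by (rule ring_hom_mult [OF q_class_hom])

lemma q_class_closed:
  "f \<in> carrier (free_algebra n) \<Longrightarrow> q_class n q f \<in> carrier (q_space n q)"
  by (simp add: q_space_carrier)

lemma q_rep_class:
  assumes "f \<in> carrier (free_algebra n)"
  shows "\<exists>h\<in>q_ideal n q. q_rep (q_class n q f) = h \<oplus>\<^bsub>free_algebra n\<^esub> f"
proof -
  have "\<zero>\<^bsub>free_algebra n\<^esub> \<in> q_ideal n q"
    using q_ideal_ideal [of n q] by (simp add: additive_subgroup.zero_closed ideal_def)
  then have "\<exists>g. g \<in> q_class n q f"
    by (auto simp: q_class_def a_r_coset_def')
  then have "q_rep (q_class n q f) \<in> q_class n q f"
    unfolding q_rep_def by (rule someI_ex)
  then show ?thesis by (auto simp: q_class_def a_r_coset_def')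
qed

lemma q_scalar_algebra: "scalar_algebra (q_space n q) (q_const n q)"
proof -
  interpret F: ring "free_algebra n :: (nat list \<Rightarrow> 'a) ring" by (rule free_algebra_ring)
  have const: "free_word c [] \<in> carrier (free_algebra n)" for c :: 'a
    by (simp add: free_word_closed)
  show ?thesis
  proof (intro scalar_algebra.intro scalar_algebra_axioms.intro q_space_ring)
    fix c d :: 'a
    show "q_const n q c \<in> carrier (q_space n q)"
      by (simp add: q_const_def q_class_closed free_const_closed)
    show "q_const n q 1 = \<one>\<^bsub>q_space n q\<^esub>"
      using ring_hom_one [OF q_class_hom, of n q] by (simp add: q_const_def free_const_word free_one)
    have "free_word (c + d) [] = free_word c [] \<oplus>\<^bsub>free_algebra n\<^esub> free_word d []"
      by (auto simp: free_add free_word_def)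
    then show "q_const n q (c + d) = q_const n q c \<oplus>\<^bsub>q_space n q\<^esub> q_const n q d"
      by (simp add: q_const_def free_const_word q_class_add const)
    have "free_word (c * d) [] = free_word c [] \<otimes>\<^bsub>free_algebra n\<^esub> free_word d []"
      by (simp add: free_word_mult)
    then show "q_const n q (c * d) = q_const n q c \<otimes>\<^bsub>q_space n q\<^esub> q_const n q d"
      by (simp add: q_const_def free_const_word q_class_mult const)
  next
    fix c and x assume "x \<in> carrier (q_space n q)"
    then obtain f where f: "f \<in> carrier (free_algebra n)" "x = q_class n q f"
      by (auto simp: q_space_carrier)
    from f(1) have "f \<otimes>\<^bsub>free_algebra n\<^esub> free_word c [] = free_word c [] \<otimes>\<^bsub>free_algebra n\<^esub> f"
    proof (induction f rule: free_induct)
      case (word d w)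
      then show ?case by (simp add: free_word_mult mult.commute)
    next
      case (add f g)
      then show ?case by (simp add: F.l_distr F.r_distr const)
    qed
    then show "x \<otimes>\<^bsub>q_space n q\<^esub> q_const n q c = q_const n q c \<otimes>\<^bsub>q_space n q\<^esub> x"
      using f by (simp add: q_const_def free_const_word const flip: q_class_mult)
  qed
qed

text \<open>
  The kernel of evaluation is an ideal; it contains the defining relations and therefore the ideal
  that they generate.
\<close>

lemma (in scalar_algebra) free_value_ideal:
  assumes b: "b \<in> {1..n} \<rightarrow> carrier B"
    and rel: "\<And>i j. 1 \<le> i \<Longrightarrow> i < j \<Longrightarrow> j \<le> n \<Longrightarrow> b i \<otimes> b j = scal (q i j) \<otimes> (b j \<otimes> b i)"
    and f: "f \<in> q_ideal n q"
  shows "f \<in> carrier (free_algebra n)" "free_value b f = \<zero>"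
proof -
  interpret F: ring "free_algebra n :: (nat list \<Rightarrow> 'a) ring" by (rule free_algebra_ring)
  interpret h: ring_hom_ring "free_algebra n" B "free_value b"
    by (rule ring_hom_ringI2 [OF free_algebra_ring ring_axioms free_value_hom [OF b]])
  have "q_ideal n q \<subseteq> a_kernel (free_algebra n) B (free_value b)"
    unfolding q_ideal_def
  proof (rule F.genideal_minimal [OF h.kernel_is_ideal])
    show "q_relations n q \<subseteq> a_kernel (free_algebra n) B (free_value b)"
    proof
      fix r assume "r \<in> q_relations n q"
      then obtain i j where ij: "1 \<le> i" "i < j" "j \<le> n"
        and r: "r = free_word 1 [i, j] \<ominus>\<^bsub>free_algebra n\<^esub> free_word (q i j) [j, i]"
        by (auto simp: q_relations_def free_var_word free_const_word free_word_mult)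
      have ijn: "i \<in> {1..n}" "j \<in> {1..n}" using ij by auto
      then have bij: "b i \<in> carrier B" "b j \<in> carrier B" using b by blast+
      have closed: "free_word 1 [i, j] \<in> carrier (free_algebra n)"
        "free_word (q i j) [j, i] \<in> carrier (free_algebra n)"
        using ijn by (auto intro!: free_word_closed)
      have words: "[i, j] \<in> lists {1..n}" "[j, i] \<in> lists {1..n}" using ijn by auto
      have "free_value b r = free_value b (free_word 1 [i, j]) \<oplus>
          \<ominus> free_value b (free_word (q i j) [j, i])"
        unfolding r a_minus_def
        using h.hom_add [OF closed(1) F.a_inv_closed [OF closed(2)]] h.hom_a_inv [OF closed(2)]
        by simp
      also have "\<dots> = b i \<otimes> b j \<oplus> \<ominus> (scal (q i j) \<otimes> (b j \<otimes> b i))"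
        unfolding free_value_word [OF b words(1)] free_value_word [OF b words(2)] using bij by simp
      also have "\<dots> = \<zero>"
        unfolding rel [OF ij] using bij by (intro r_neg) auto
      finally have "free_value b r = \<zero>" .
      moreover have "r \<in> carrier (free_algebra n)"
        unfolding r by (rule F.minus_closed [OF closed])
      ultimately show "r \<in> a_kernel (free_algebra n) B (free_value b)"
        unfolding a_kernel_def' by blast
    qed
  qed
  then show "f \<in> carrier (free_algebra n)" "free_value b f = \<zero>"
    using f unfolding a_kernel_def' by blast+
qed

text \<open>
  The homomorphism out of quantum affine space determined by the images \<open>b i\<close> of the variables. It
  is well defined as soon as these images satisfy the defining relations.
\<close>

definition (in scalar_algebra) q_lift :: "(nat \<Rightarrow> 'b) \<Rightarrow> (nat list \<Rightarrow> 'a) set \<Rightarrow> 'b" where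
  "q_lift b x = free_value b (q_rep x)"

context scalar_algebra
begin

context
  fixes n :: nat and q :: "nat \<Rightarrow> nat \<Rightarrow> 'a" and b :: "nat \<Rightarrow> 'b"
  assumes b: "b \<in> {1..n} \<rightarrow> carrier B"
    and rel: "\<And>i j. 1 \<le> i \<Longrightarrow> i < j \<Longrightarrow> j \<le> n \<Longrightarrow> b i \<otimes> b j = scal (q i j) \<otimes> (b j \<otimes> b i)"
begin

lemma q_lift_class: "f \<in> carrier (free_algebra n) \<Longrightarrow> q_lift b (q_class n q f) = free_value b f"
proof -
  assume f: "f \<in> carrier (free_algebra n)"
  then obtain h where h: "h \<in> q_ideal n q" "q_rep (q_class n q f) = h \<oplus>\<^bsub>free_algebra n\<^esub> f"
    using q_rep_class by blast
  have "h \<in> carrier (free_algebra n)" "free_value b h = \<zero>"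
    using free_value_ideal [OF b rel h(1)] by auto
  then show ?thesis
    using f h(2) by (simp add: q_lift_def free_value_add [OF b] free_value_closed [OF b])
qed

lemma q_lift_hom: "q_lift b \<in> ring_hom (q_space n q) B"
proof -
  interpret F: ring "free_algebra n :: (nat list \<Rightarrow> 'a) ring" by (rule free_algebra_ring)
  show ?thesis
  proof (rule ring_hom_memI)
    have "q_lift b (q_class n q \<one>\<^bsub>free_algebra n\<^esub>) = \<one>"
      using ring_hom_one [OF free_value_hom [OF b]] by (simp only: q_lift_class F.one_closed)
    then show "q_lift b \<one>\<^bsub>q_space n q\<^esub> = \<one>"
      by (simp only: ring_hom_one [OF q_class_hom])
  next
    fix x assume "x \<in> carrier (q_space n q)"
    then obtain f where f: "f \<in> carrier (free_algebra n)" "x = q_class n q f"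
      by (auto simp: q_space_carrier)
    show "q_lift b x \<in> carrier B"
      unfolding f(2) q_lift_class [OF f(1)] using f(1) by (rule free_value_closed [OF b])
    fix y assume "y \<in> carrier (q_space n q)"
    then obtain g where g: "g \<in> carrier (free_algebra n)" "y = q_class n q g"
      by (auto simp: q_space_carrier)
    show "q_lift b (x \<otimes>\<^bsub>q_space n q\<^esub> y) = q_lift b x \<otimes> q_lift b y"
      unfolding f(2) g(2) q_class_mult [OF f(1) g(1), symmetric] q_lift_class [OF f(1)]
        q_lift_class [OF g(1)] q_lift_class [OF F.m_closed [OF f(1) g(1)]]
      by (rule free_value_mult [OF b f(1) g(1)])
    show "q_lift b (x \<oplus>\<^bsub>q_space n q\<^esub> y) = q_lift b x \<oplus> q_lift b y"
      unfolding f(2) g(2) q_class_add [OF f(1) g(1), symmetric] q_lift_class [OF f(1)]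
        q_lift_class [OF g(1)] q_lift_class [OF F.a_closed [OF f(1) g(1)]]
      by (rule free_value_add [OF b f(1) g(1)])
  qed
qed

lemma q_lift_var:
  assumes i: "i \<in> {1..n}"
  shows "q_lift b (q_var n q i) = b i"
proof -
  have "q_lift b (q_var n q i) = free_value b (free_word 1 [i])"
    using q_lift_class [OF free_var_closed [OF i]] by (simp add: q_var_class free_var_word)
  also have "\<dots> = scal 1 \<otimes> word_value b [i]"
    using i by (intro free_value_word [OF b]) auto
  also have "\<dots> = b i"
    using b i by (simp add: Pi_iff)
  finally show ?thesis .
qed

lemma q_lift_const: "q_lift b (q_const n q c) = scal c"
  by (simp add: q_const_def q_lift_class free_const_closed)
     (simp add: free_const_word free_value_word [OF b])

end

end

section \<open>Generators and relations of quantum affine space\<close>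

locale quantum_space =
  fixes n :: nat and q :: "nat \<Rightarrow> nat \<Rightarrow> 'a::field" and A (structure)
  assumes antisym: "mult_antisym n q" and A_eq: "A = q_space n q"

sublocale quantum_space \<subseteq> scalar_algebra A "q_const n q"
  unfolding A_eq by (rule q_scalar_algebra)

context quantum_space
begin

abbreviation X where "X \<equiv> q_var n q"

lemma q_nonzero: "i \<in> {1..n} \<Longrightarrow> j \<in> {1..n} \<Longrightarrow> q i j \<noteq> 0"
  using antisym unfolding mult_antisym_def by blast

lemma q_diag: "i \<in> {1..n} \<Longrightarrow> q i i = 1"
  using antisym unfolding mult_antisym_def by blast

lemma q_inverse: "i \<in> {1..n} \<Longrightarrow> j \<in> {1..n} \<Longrightarrow> q j i = inverse (q i j)"
  using antisym unfolding mult_antisym_def by blast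

lemma q_swap: "i \<in> {1..n} \<Longrightarrow> j \<in> {1..n} \<Longrightarrow> q i j * q j i = 1"
  using q_nonzero [of i j] q_inverse [of i j] by simp

lemma X_closed [simp]: "i \<in> {1..n} \<Longrightarrow> X i \<in> carrier A"
  by (simp add: A_eq q_var_class q_class_closed free_var_closed)

lemma X_Pi: "X \<in> {1..n} \<rightarrow> carrier A"
  by simp

lemma class_word: "w \<in> lists {1..n} \<Longrightarrow>
    q_class n q (free_word c w) = q_const n q c \<otimes> word_value X w"
proof (induction w arbitrary: c)
  case Nil
  then show ?case using scal_closed [of c] by (simp add: q_const_def free_const_word)
next
  case (Cons i w)
  have "q_class n q (free_word c (i # w)) =
      q_class n q (free_word 1 [i] \<otimes>\<^bsub>free_algebra n\<^esub> free_word c w)"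
    by (simp add: free_word_mult)
  also have "\<dots> = q_class n q (free_word 1 [i]) \<otimes> q_class n q (free_word c w)"
    unfolding A_eq using Cons by (intro q_class_mult free_word_closed) auto
  also have "\<dots> = X i \<otimes> (q_const n q c \<otimes> word_value X w)"
    using Cons by (simp add: q_var_class [of n q i] free_var_word)
  also have "\<dots> = q_const n q c \<otimes> word_value X (i # w)"
    using Cons word_value_closed [OF X_Pi, of w] by (simp add: scal_left_commute)
  finally show ?case .
qed

text \<open>
  Quantum affine space is generated by the constants and the variables. Homomorphisms and derivations
  are compared by this rule.
\<close>

lemma q_space_induct [consumes 1, case_names const var add mult]:
  assumes "x \<in> carrier A"
    and const: "\<And>c. P (q_const n q c)"
    and var: "\<And>i. i \<in> {1..n} \<Longrightarrow> P (X i)"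
    and add: "\<And>x y. x \<in> carrier A \<Longrightarrow> y \<in> carrier A \<Longrightarrow> P x \<Longrightarrow> P y \<Longrightarrow> P (x \<oplus> y)"
    and mult: "\<And>x y. x \<in> carrier A \<Longrightarrow> y \<in> carrier A \<Longrightarrow> P x \<Longrightarrow> P y \<Longrightarrow> P (x \<otimes> y)"
  shows "P x"
proof -
  have word: "P (word_value X w)" if "w \<in> lists {1..n}" for w
    using that
  proof (induction w)
    case Nil
    then show ?case using const [of 1] by simp
  next
    case (Cons i w)
    then show ?case
      using mult [of "X i" "word_value X w"] var word_value_closed [OF X_Pi] by auto
  qed
  obtain f where "f \<in> carrier (free_algebra n)" and x: "x = q_class n q f"
    using assms(1) by (auto simp: A_eq q_space_carrier)
  from this(1) have "P (q_class n q f)"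
  proof (induction f rule: free_induct)
    case (word c w)
    then show ?case
      using mult \<open>\<And>w. w \<in> lists {1..n} \<Longrightarrow> P (word_value X w)\<close> const word_value_closed [OF X_Pi]
      by (simp add: class_word)
  next
    case (add f g)
    then show ?case
      using assms(4) [of "q_class n q f" "q_class n q g"] by (simp add: q_class_add q_class_closed A_eq)
  qed
  then show ?thesis by (simp add: x)
qed

lemma X_commute_less:
  assumes "1 \<le> i" "i < j" "j \<le> n"
  shows "X i \<otimes> X j = q_const n q (q i j) \<otimes> (X j \<otimes> X i)"
proof -
  interpret F: ring "free_algebra n :: (nat list \<Rightarrow> 'a) ring" by (rule free_algebra_ring)
  interpret I: ideal "q_ideal n q" "free_algebra n" by (rule q_ideal_ideal)
  have ij: "i \<in> {1..n}" "j \<in> {1..n}" using assms by auto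
  let ?f = "free_word 1 [i, j]" and ?g = "free_word (q i j) [j, i]"
  have closed: "?f \<in> carrier (free_algebra n)" "?g \<in> carrier (free_algebra n)"
    using ij by (auto intro!: free_word_closed)
  have "?f \<ominus>\<^bsub>free_algebra n\<^esub> ?g \<in> q_relations n q"
    using assms by (fastforce simp: q_relations_def free_var_word free_const_word free_word_mult)
  moreover have "q_relations n q \<subseteq> carrier (free_algebra n)"
    by (auto simp: q_relations_def intro!: F.minus_closed F.m_closed free_var_closed free_const_closed)
  ultimately have "?f \<ominus>\<^bsub>free_algebra n\<^esub> ?g \<in> q_ideal n q"
    unfolding q_ideal_def using F.genideal_self by blast
  then have "?f \<in> q_class n q ?g"
    unfolding q_class_def using closed I.a_rcos_module_minus [OF F.ring_axioms] by blast
  then have "q_class n q ?f = q_class n q ?g"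
    unfolding q_class_def using closed I.a_repr_independence' [of ?f ?g] by simp
  then show ?thesis
    using ij by (simp add: class_word m_assoc)
qed

lemma X_commute:
  assumes "i \<in> {1..n}" "j \<in> {1..n}"
  shows "X i \<otimes> X j = q_const n q (q i j) \<otimes> (X j \<otimes> X i)"
proof (cases i j rule: linorder_cases)
  case less
  then show ?thesis using assms by (intro X_commute_less) auto
next
  case equal
  then show ?thesis using assms by (simp add: q_diag)
next
  case greater
  have "X j \<otimes> X i = q_const n q (q j i) \<otimes> (X i \<otimes> X j)"
    using greater assms by (intro X_commute_less) auto
  then show ?thesis
    using assms by (simp add: scal_scal q_swap)
qed

end

section \<open>Coordinates with respect to the ordered monomials\<close>

text \<open>
  A monomial is given by the multiset of its indices. Moving the factors of the ordered monomial of
  \<open>N\<close> into their places within that of \<open>M\<close> costs one factor \<open>q k l\<close> for each inversion, whence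
  \<open>X\<^sup>M X\<^sup>N = twist q M N \<cdot> X\<^bsup>M + N\<^esup>\<close>. Multisets are convenient because the multiset of a word is
  immediate and because their order is total and compatible with addition.
\<close>

definition twist :: "(nat \<Rightarrow> nat \<Rightarrow> 'a::field) \<Rightarrow> nat multiset \<Rightarrow> nat multiset \<Rightarrow> 'a" where
  "twist q M N = (\<Prod>k\<in>#M. \<Prod>l\<in>#N. if l < k then q k l else 1)"

text \<open>
  The scalar by which a word differs from the ordered monomial with the same letters.
\<close>

primrec word_twist :: "(nat \<Rightarrow> nat \<Rightarrow> 'a::field) \<Rightarrow> nat list \<Rightarrow> 'a" where
  "word_twist q [] = 1"
| "word_twist q (k # w) = twist q {#k#} (mset w) * word_twist q w"

text \<open>
  The coefficient of the ordered monomial of \<open>M\<close> after each word of \<open>f\<close> has been sorted.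
\<close>

definition word_coord :: "(nat \<Rightarrow> nat \<Rightarrow> 'a::field) \<Rightarrow> (nat list \<Rightarrow> 'a) \<Rightarrow> nat multiset \<Rightarrow> 'a" where
  "word_coord q f M = (\<Sum>w\<in>{w. mset w = M}. word_twist q w * f w)"

lemma twist_empty [simp]: "twist q {#} N = 1" "twist q M {#} = 1"
  by (simp_all add: twist_def)

lemma twist_add_left: "twist q (M + M') N = twist q M N * twist q M' N"
  by (simp add: twist_def)

lemma twist_add_right: "twist q M (N + N') = twist q M N * twist q M N'"
  by (simp add: twist_def prod_mset.distrib)

lemma word_twist_append:
  "word_twist q (u @ v) = word_twist q u * word_twist q v * twist q (mset u) (mset v)"
proof (induction u)
  case (Cons k u)
  then show ?case
    using twist_add_left [of q "{#k#}" "mset u" "mset v"] by (simp add: twist_add_right)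
qed simp

lemma twist_sorted: "(\<And>l. l \<in># N \<Longrightarrow> k \<le> l) \<Longrightarrow> twist q {#k#} N = 1"
proof (induction N)
  case (add l N)
  have "\<not> l < k" using add.prems [of l] by simp
  then show ?case
    using add twist_add_right [of q "{#k#}" "{#l#}" N] by (simp add: twist_def)
qed simp

lemma word_twist_sorted: "sorted w \<Longrightarrow> word_twist q w = 1"
proof (induction w)
  case (Cons k w)
  then show ?case using twist_sorted [of "mset w" k q] by auto
qed simp

lemma finite_multiset_splits: "finite {(M, N). M + N = (K :: 'b multiset)}"
proof -
  have "finite (mset ` {w. set w \<subseteq> set_mset K \<and> length w \<le> size K})"
    by (intro finite_imageI finite_lists_length_le) simp
  moreover have "{M. M \<subseteq># K} \<subseteq> mset ` {w. set w \<subseteq> set_mset K \<and> length w \<le> size K}"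
  proof
    fix M assume M: "M \<in> {M. M \<subseteq># K}"
    obtain w where "mset w = M" using ex_mset by blast
    then show "M \<in> mset ` {w. set w \<subseteq> set_mset K \<and> length w \<le> size K}"
      using M by (intro image_eqI [of _ _ w])
        (auto dest: mset_subset_eqD size_mset_mono simp flip: set_mset_mset size_mset)
  qed
  ultimately have "finite {M. M \<subseteq># K}" by (rule finite_subset [rotated])
  then have "finite ({M. M \<subseteq># K} \<times> {M. M \<subseteq># K})" by simp
  then show ?thesis by (rule finite_subset [rotated]) auto
qed

lemma finite_mset_fibre [simp]: "finite {w. mset w = M}"
proof -
  obtain v where "mset v = M" using ex_mset by blast
  then show ?thesis using mset_eq_finite [of v] by simp
qed

lemma word_coord_add: "word_coord q (\<lambda>w. f w + g w) M = word_coord q f M + word_coord q g M"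
  by (simp add: word_coord_def distrib_left sum.distrib)

lemma word_coord_uminus: "word_coord q (\<lambda>w. - f w) M = - word_coord q f M"
  by (simp add: word_coord_def sum_negf)

lemma word_coord_zero [simp]: "word_coord q (\<lambda>w. 0) M = 0"
  by (simp add: word_coord_def)

lemma word_coord_word:
  "word_coord q (free_word c w) M = (if M = mset w then word_twist q w * c else 0)"
proof -
  have "word_coord q (free_word c w) M =
      (\<Sum>v\<in>{v. mset v = M}. if v = w then word_twist q w * c else 0)"
    unfolding word_coord_def by (rule sum.cong) (auto simp: free_word_def)
  then show ?thesis by (cases "M = mset w") (auto simp: intro!: sum.neutral)
qed

text \<open>
  Sorting turns concatenation into the twisted product of monomials. By additivity in both arguments
  this reduces to two words, where it is \<open>word_twist_append\<close>.
\<close>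

lemma word_coord_mult:
  assumes "f \<in> carrier (free_algebra n)" "g \<in> carrier (free_algebra n)"
  shows "word_coord q (f \<otimes>\<^bsub>free_algebra n\<^esub> g) K =
    (\<Sum>(M, N)\<in>{(M, N). M + N = K}. twist q M N * word_coord q f M * word_coord q g N)"
proof -
  interpret F: ring "free_algebra n :: (nat list \<Rightarrow> 'a) ring" by (rule free_algebra_ring)
  have words: "word_coord q (free_word c u \<otimes>\<^bsub>free_algebra n\<^esub> free_word d v) K =
      (\<Sum>(M, N)\<in>{(M, N). M + N = K}.
         twist q M N * word_coord q (free_word c u) M * word_coord q (free_word d v) N)" for c u d v
  proof -
    have "(\<Sum>(M, N)\<in>{(M, N). M + N = K}.
        twist q M N * word_coord q (free_word c u) M * word_coord q (free_word d v) N) =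
      (\<Sum>p\<in>{(M, N). M + N = K}. if p = (mset u, mset v)
         then twist q (mset u) (mset v) * (word_twist q u * c) * (word_twist q v * d) else 0)"
      by (rule sum.cong) (auto simp: word_coord_word split: if_splits)
    then show ?thesis
      by (simp add: finite_multiset_splits free_word_mult word_coord_word word_twist_append)
  qed
  have word: "word_coord q (free_word c u \<otimes>\<^bsub>free_algebra n\<^esub> g) K =
      (\<Sum>(M, N)\<in>{(M, N). M + N = K}. twist q M N * word_coord q (free_word c u) M * word_coord q g N)"
    if u: "u \<in> lists {1..n}" for c u
    using assms(2)
  proof (induction g rule: free_induct)
    case (add h k)
    then show ?case
      using free_word_closed [OF u, of c]
      by (simp add: F.r_distr) (simp add: free_add word_coord_add distrib_left case_prod_beta sum.distrib)
  qed (rule words)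
  show ?thesis
    using assms(1)
  proof (induction f rule: free_induct)
    case (add h k)
    then show ?case
      using assms(2)
      by (simp add: F.l_distr)
         (simp add: free_add word_coord_add distrib_left distrib_right case_prod_beta sum.distrib)
  qed (rule word)
qed

lemma word_coord_support:
  assumes "f \<in> carrier (free_algebra n)"
  shows "finite {M. word_coord q f M \<noteq> 0}" "{M. word_coord q f M \<noteq> 0} \<subseteq> {M. set_mset M \<subseteq> {1..n}}"
proof -
  have sub: "{M. word_coord q f M \<noteq> 0} \<subseteq> mset ` {w. f w \<noteq> 0}"
  proof
    fix M assume "M \<in> {M. word_coord q f M \<noteq> 0}"
    then have "(\<Sum>w\<in>{w. mset w = M}. word_twist q w * f w) \<noteq> 0"
      by (simp add: word_coord_def)
    then obtain w where "w \<in> {w. mset w = M}" "word_twist q w * f w \<noteq> 0"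
      by (rule sum.not_neutral_contains_not_neutral)
    then show "M \<in> mset ` {w. f w \<noteq> 0}" by auto
  qed
  have f: "finite {w. f w \<noteq> 0}" "{w. f w \<noteq> 0} \<subseteq> lists {1..n}"
    using assms by (auto simp: free_algebra_def)
  show "finite {M. word_coord q f M \<noteq> 0}"
    using sub finite_imageI [OF f(1)] by (rule finite_subset)
  have "mset ` {w. f w \<noteq> 0} \<subseteq> {M. set_mset M \<subseteq> {1..n}}"
  proof (rule image_subsetI)
    fix w assume "w \<in> {w. f w \<noteq> 0}"
    then have "w \<in> lists {1..n}" using f(2) by blast
    then show "mset w \<in> {M. set_mset M \<subseteq> {1..n}}" by (simp only: lists_eq_set mem_Collect_eq set_mset_mset)
  qed
  then show "{M. word_coord q f M \<noteq> 0} \<subseteq> {M. set_mset M \<subseteq> {1..n}}"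
    using sub by (rule subset_trans [rotated])
qed

context quantum_space
begin

lemma twist_nonzero:
  assumes "set_mset M \<subseteq> {1..n}" "set_mset N \<subseteq> {1..n}"
  shows "twist q M N \<noteq> 0"
proof -
  have "q k l \<noteq> 0" if "k \<in># M" "l \<in># N" for k l
    using assms that by (intro q_nonzero) blast+
  then show ?thesis
    by (auto simp: twist_def prod_mset_zero_iff split: if_splits)
qed

text \<open>
  A variable is carried past one smaller letter at a time, as in insertion sort.
\<close>

lemma X_move:
  assumes "k \<in> {1..n}" "w \<in> lists {1..n}" "sorted w"
  shows "X k \<otimes> word_value X w = q_const n q (twist q {#k#} (mset w)) \<otimes> word_value X (insort k w)"
  using assms
proof (induction w)
  case Nil
  then show ?case by simp
next
  case (Cons l w)
  have l: "l \<in> {1..n}" and w: "w \<in> lists {1..n}" "sorted w" using Cons by auto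
  have closed: "word_value X w \<in> carrier A" "word_value X (insort k w) \<in> carrier A"
    using w Cons(2) word_value_closed [OF X_Pi, of w] word_value_closed [OF X_Pi, of "insort k w"]
    by (auto simp: in_lists_conv_set set_insort_key)
  show ?case
  proof (cases "k \<le> l")
    case True
    then have "twist q {#k#} (mset (l # w)) = 1"
      using Cons(4) by (intro twist_sorted) auto
    then show ?thesis using True Cons(2) l closed by simp
  next
    case False
    have tw: "twist q {#k#} (mset (l # w)) = q k l * twist q {#k#} (mset w)"
      using False twist_add_right [of q "{#k#}" "{#l#}" "mset w"] by (simp add: twist_def)
    have "X k \<otimes> word_value X (l # w) = (X k \<otimes> X l) \<otimes> word_value X w"
      using Cons(2) l closed by (simp add: m_assoc)
    also have "\<dots> = q_const n q (q k l) \<otimes> (X l \<otimes> (X k \<otimes> word_value X w))"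
      using Cons(2) l closed by (simp add: X_commute [of k l] m_assoc)
    also have "X k \<otimes> word_value X w =
        q_const n q (twist q {#k#} (mset w)) \<otimes> word_value X (insort k w)"
      by (rule Cons.IH [OF Cons(2) w])
    also have "X l \<otimes> \<dots> = q_const n q (twist q {#k#} (mset w)) \<otimes> (X l \<otimes> word_value X (insort k w))"
      using l closed by (simp add: scal_left_commute)
    finally show ?thesis
      using False l closed tw by (simp add: scal_scal)
  qed
qed

lemma word_value_sort:
  "w \<in> lists {1..n} \<Longrightarrow> word_value X w = q_const n q (word_twist q w) \<otimes> word_value X (sort w)"
proof (induction w)
  case (Cons k w)
  have kw: "k \<in> {1..n}" "w \<in> lists {1..n}" "sort w \<in> lists {1..n}"
    "insort k (sort w) \<in> lists {1..n}"
    using Cons(2) by (auto simp: in_lists_conv_set set_insort_key)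
  note closed = word_value_closed [OF X_Pi kw(3)] word_value_closed [OF X_Pi kw(4)]
  have "word_value X (k # w) =
      q_const n q (word_twist q w) \<otimes> (X k \<otimes> word_value X (sort w))"
    using Cons(1) kw closed by (simp add: scal_left_commute)
  also have "X k \<otimes> word_value X (sort w) =
      q_const n q (twist q {#k#} (mset w)) \<otimes> word_value X (insort k (sort w))"
    using X_move [OF kw(1) kw(3)] by simp
  finally show ?case
    using closed by (simp add: scal_scal mult.commute)
qed simp

text \<open>
  The representative supported on sorted words with prescribed coordinates. It shows both that the
  ordered monomials span (\<open>class_sorted_rep\<close>) and that any finitely supported family of coordinates
  occurs (\<open>coord_surj\<close>).
\<close>

definition sorted_rep :: "(nat multiset \<Rightarrow> 'a) \<Rightarrow> nat list \<Rightarrow> 'a" where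
  "sorted_rep F w = (if sorted w then F (mset w) else 0)"

lemma sorted_rep_closed:
  assumes "finite {M. F M \<noteq> 0}" "{M. F M \<noteq> 0} \<subseteq> {M. set_mset M \<subseteq> {1..n}}"
  shows "sorted_rep F \<in> carrier (free_algebra n)"
proof -
  have "{w. sorted_rep F w \<noteq> 0} \<subseteq> sorted_list_of_multiset ` {M. F M \<noteq> 0}"
  proof
    fix w assume "w \<in> {w. sorted_rep F w \<noteq> 0}"
    then have "sorted w" "F (mset w) \<noteq> 0" by (auto simp: sorted_rep_def split: if_splits)
    then show "w \<in> sorted_list_of_multiset ` {M. F M \<noteq> 0}"
      by (intro image_eqI [of _ _ "mset w"]) (auto simp: sorted_sort_id)
  qed
  moreover have "sorted_list_of_multiset ` {M. F M \<noteq> 0} \<subseteq> lists {1..n}"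
    using assms(2) by (fastforce simp: lists_eq_set simp del: atLeastAtMost_iff)
  ultimately show ?thesis
    using assms(1) unfolding free_algebra_def by (auto intro: finite_subset)
qed

lemma class_sorted_rep:
  "f \<in> carrier (free_algebra n) \<Longrightarrow> q_class n q (sorted_rep (word_coord q f)) = q_class n q f"
proof (induction f rule: free_induct)
  case (word c w)
  have "sorted_rep (word_coord q (free_word c w)) v = free_word (word_twist q w * c) (sort w) v" for v
  proof (cases "v = sort w")
    case True
    then show ?thesis by (simp add: sorted_rep_def word_coord_word free_word_def [of _ "sort w"])
  next
    case False
    then have "\<not> (sorted v \<and> mset v = mset w)"
      using properties_for_sort [of v w] by auto
    with False show ?thesis
      by (auto simp: sorted_rep_def word_coord_word free_word_def [of _ "sort w"])
  qed
  then have "sorted_rep (word_coord q (free_word c w)) = free_word (word_twist q w * c) (sort w)" ..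
  moreover have "sort w \<in> lists {1..n}" using word by (auto simp: in_lists_conv_set)
  ultimately show ?case
    using word word_value_closed [OF X_Pi, of "sort w"]
    by (simp add: class_word word_value_sort [of w] scal_scal mult.commute)
next
  case (add f g)
  have "sorted_rep (word_coord q (f \<oplus>\<^bsub>free_algebra n\<^esub> g)) =
      sorted_rep (word_coord q f) \<oplus>\<^bsub>free_algebra n\<^esub> sorted_rep (word_coord q g)"
    by (auto simp: free_add word_coord_add sorted_rep_def)
  then show ?case
    using add sorted_rep_closed [OF word_coord_support [OF add(1)]]
      sorted_rep_closed [OF word_coord_support [OF add(2)]]
    by (simp add: q_class_add)
qed

lemma word_coord_sorted_rep: "word_coord q (sorted_rep F) = F"
proof
  fix M
  have "word_coord q (sorted_rep F) M =
      (\<Sum>w\<in>{w. mset w = M}. if w = sorted_list_of_multiset M then F M else 0)"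
    unfolding word_coord_def
  proof (rule sum.cong)
    fix w assume "w \<in> {w. mset w = M}"
    then have w: "mset w = M" by simp
    then have "sorted w \<longleftrightarrow> w = sorted_list_of_multiset M"
      using sorted_sort_id [of w] by (metis sorted_list_of_multiset_mset sorted_sort)
    then show "word_twist q w * sorted_rep F w = (if w = sorted_list_of_multiset M then F M else 0)"
      using w by (cases "sorted w") (auto simp: sorted_rep_def word_twist_sorted)
  qed simp
  then show "word_coord q (sorted_rep F) M = F M"
    by simp
qed

text \<open>
  The coordinates are well defined on the quotient: by the product formula their common kernel is an
  ideal, and each defining relation lies in it. This is the linear independence of the ordered
  monomials.
\<close>

lemma word_coord_ideal:
  assumes "f \<in> q_ideal n q"
  shows "f \<in> carrier (free_algebra n)" "word_coord q f = (\<lambda>M. 0)"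
proof -
  interpret F: ring "free_algebra n :: (nat list \<Rightarrow> 'a) ring" by (rule free_algebra_ring)
  let ?K = "{f \<in> carrier (free_algebra n). word_coord q f = (\<lambda>M. 0)}"
  have "ideal ?K (free_algebra n)"
  proof (rule idealI [OF free_algebra_ring])
    show "subgroup ?K (add_monoid (free_algebra n))"
    proof (rule F.add.subgroupI)
      have "\<zero>\<^bsub>free_algebra n\<^esub> \<in> ?K" 
        using F.zero_closed by (simp add: free_zero fun_eq_iff)
      then show "?K \<noteq> {}" by blast
      fix f assume f: "f \<in> ?K"
      then have fc: "f \<in> carrier (free_algebra n)" by simp
      have minus: "\<ominus>\<^bsub>free_algebra n\<^esub> f = (\<lambda>w. - f w)"
        using free_minus [OF F.zero_closed fc] by (simp add: free_zero a_minus_def free_add)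
      have "word_coord q (\<ominus>\<^bsub>free_algebra n\<^esub> f) = (\<lambda>M. 0)"
        unfolding minus using f by (simp add: word_coord_uminus fun_eq_iff)
      then show "\<ominus>\<^bsub>free_algebra n\<^esub> f \<in> ?K"
        using F.a_inv_closed [OF fc] by simp
      fix g assume g: "g \<in> ?K"
      then show "f \<oplus>\<^bsub>free_algebra n\<^esub> g \<in> ?K"
        using f F.a_closed [of f g] by (auto simp: free_add word_coord_add fun_eq_iff)
    qed auto
  next
    fix f g :: "nat list \<Rightarrow> 'a" assume "f \<in> ?K" "g \<in> carrier (free_algebra n)"
    then show "g \<otimes>\<^bsub>free_algebra n\<^esub> f \<in> ?K" "f \<otimes>\<^bsub>free_algebra n\<^esub> g \<in> ?K"
      by (auto simp: word_coord_mult fun_eq_iff)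
  qed
  moreover have "q_relations n q \<subseteq> ?K"
  proof
    fix r assume "r \<in> q_relations n q"
    then obtain i j where ij: "1 \<le> i" "i < j" "j \<le> n"
      and r: "r = free_word 1 [i, j] \<ominus>\<^bsub>free_algebra n\<^esub> free_word (q i j) [j, i]"
      by (auto simp: q_relations_def free_var_word free_const_word free_word_mult)
    have closed: "free_word 1 [i, j] \<in> carrier (free_algebra n)"
      "free_word (q i j) [j, i] \<in> carrier (free_algebra n)"
      using ij by (auto intro!: free_word_closed)
    have rw: "r = (\<lambda>w. free_word 1 [i, j] w + - free_word (q i j) [j, i] w)"
      unfolding r free_minus [OF closed] by simp
    have "word_coord q r M = 0" for M
      unfolding rw word_coord_add word_coord_uminus word_coord_word
      using ij q_swap [of j i] by (simp add: twist_def add_mset_commute)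
    then show "r \<in> ?K"
      using F.minus_closed [OF closed] r by auto
  qed
  ultimately have "q_ideal n q \<subseteq> ?K"
    unfolding q_ideal_def by (rule F.genideal_minimal)
  then show "f \<in> carrier (free_algebra n)" "word_coord q f = (\<lambda>M. 0)" using assms by auto
qed

definition coord :: "(nat list \<Rightarrow> 'a) set \<Rightarrow> nat multiset \<Rightarrow> 'a" where
  "coord x = word_coord q (q_rep x)"

lemma coord_class: "f \<in> carrier (free_algebra n) \<Longrightarrow> coord (q_class n q f) = word_coord q f"
proof -
  assume f: "f \<in> carrier (free_algebra n)"
  then obtain h where h: "h \<in> q_ideal n q" "q_rep (q_class n q f) = h \<oplus>\<^bsub>free_algebra n\<^esub> f"
    using q_rep_class by blast
  show ?thesis
    using word_coord_ideal(2) [OF h(1)]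
    by (auto simp: coord_def h(2) free_add word_coord_add fun_eq_iff)
qed

lemma carrier_class_cases:
  assumes "x \<in> carrier A"
  obtains f where "f \<in> carrier (free_algebra n)" "x = q_class n q f"
  using assms by (auto simp: A_eq q_space_carrier)

lemma coord_add:
  assumes "x \<in> carrier A" "y \<in> carrier A"
  shows "coord (x \<oplus> y) M = coord x M + coord y M"
proof -
  interpret F: ring "free_algebra n :: (nat list \<Rightarrow> 'a) ring" by (rule free_algebra_ring)
  obtain f where f: "f \<in> carrier (free_algebra n)" "x = q_class n q f"
    using carrier_class_cases [OF assms(1)] .
  obtain g where g: "g \<in> carrier (free_algebra n)" "y = q_class n q g"
    using carrier_class_cases [OF assms(2)] .
  note fg = f g
  have "x \<oplus> y = q_class n q (f \<oplus>\<^bsub>free_algebra n\<^esub> g)"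
    using fg by (simp add: q_class_add A_eq)
  then show ?thesis
    using fg by (simp add: coord_class) (simp add: free_add word_coord_add)
qed

lemma coord_mult:
  assumes "x \<in> carrier A" "y \<in> carrier A"
  shows "coord (x \<otimes> y) K = (\<Sum>(M, N)\<in>{(M, N). M + N = K}. twist q M N * coord x M * coord y N)"
proof -
  interpret F: ring "free_algebra n :: (nat list \<Rightarrow> 'a) ring" by (rule free_algebra_ring)
  obtain f where f: "f \<in> carrier (free_algebra n)" "x = q_class n q f"
    using carrier_class_cases [OF assms(1)] .
  obtain g where g: "g \<in> carrier (free_algebra n)" "y = q_class n q g"
    using carrier_class_cases [OF assms(2)] .
  note fg = f g
  have "x \<otimes> y = q_class n q (f \<otimes>\<^bsub>free_algebra n\<^esub> g)"
    using fg by (simp add: q_class_mult A_eq)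
  then show ?thesis
    using fg by (simp add: coord_class word_coord_mult)
qed

lemma coord_const: "coord (q_const n q c) M = (if M = {#} then c else 0)"
  by (simp add: q_const_def coord_class free_const_closed) (simp add: free_const_word word_coord_word)

lemma coord_X: "i \<in> {1..n} \<Longrightarrow> coord (X i) M = (if M = {#i#} then 1 else 0)"
  by (simp add: q_var_class coord_class free_var_closed)
     (simp add: free_var_word word_coord_word)

lemma coord_inject:
  assumes "x \<in> carrier A" "y \<in> carrier A" "coord x = coord y"
  shows "x = y"
proof -
  obtain f where f: "f \<in> carrier (free_algebra n)" "x = q_class n q f"
    using carrier_class_cases [OF assms(1)] .
  obtain g where g: "g \<in> carrier (free_algebra n)" "y = q_class n q g"
    using carrier_class_cases [OF assms(2)] .
  note fg = f g
  then have "word_coord q f = word_coord q g" using assms(3) by (simp add: coord_class)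
  then show ?thesis using class_sorted_rep [of f] class_sorted_rep [of g] fg by simp
qed

lemma coord_finite: "x \<in> carrier A \<Longrightarrow> finite {M. coord x M \<noteq> 0}"
  by (elim carrier_class_cases) (simp add: coord_class word_coord_support(1))

lemma coord_support:
  assumes "x \<in> carrier A" "coord x M \<noteq> 0"
  shows "set_mset M \<subseteq> {1..n}"
proof -
  obtain f where f: "f \<in> carrier (free_algebra n)" "x = q_class n q f"
    using carrier_class_cases [OF assms(1)] .
  then show ?thesis
    using word_coord_support(2) [OF f(1), of q] assms(2) by (auto simp: coord_class)
qed

lemma coord_surj:
  assumes "finite {M. F M \<noteq> 0}" "\<And>M. F M \<noteq> 0 \<Longrightarrow> set_mset M \<subseteq> {1..n}"
  obtains x where "x \<in> carrier A" "coord x = F"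
proof
  have rep: "sorted_rep F \<in> carrier (free_algebra n)"
    using assms by (intro sorted_rep_closed) auto
  then show "q_class n q (sorted_rep F) \<in> carrier A"
    by (simp add: A_eq q_class_closed)
  show "coord (q_class n q (sorted_rep F)) = F"
    using rep by (simp add: coord_class word_coord_sorted_rep)
qed

end

section \<open>Extreme monomials and skew commutation\<close>

context quantum_space
begin

lemma coord_zero [simp]: "coord \<zero> M = 0"
  using coord_const [of 0 M] by simp

lemma coord_nonzero: "x \<in> carrier A \<Longrightarrow> x \<noteq> \<zero> \<Longrightarrow> {M. coord x M \<noteq> 0} \<noteq> {}"
  using coord_inject [of x \<zero>] by (auto simp: fun_eq_iff)

lemma coord_mult_split:
  assumes "x \<in> carrier A" "y \<in> carrier A" "coord (x \<otimes> y) K \<noteq> 0"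
  obtains M N where "K = M + N" "coord x M \<noteq> 0" "coord y N \<noteq> 0"
proof -
  have "(\<Sum>(M, N)\<in>{(M, N). M + N = K}. twist q M N * coord x M * coord y N) \<noteq> 0"
    using assms by (simp add: coord_mult)
  then obtain p where "p \<in> {(M, N). M + N = K}"
    "(case p of (M, N) \<Rightarrow> twist q M N * coord x M * coord y N) \<noteq> 0"
    by (rule sum.not_neutral_contains_not_neutral)
  then show thesis using that by (cases p) auto
qed

text \<open>
  If only one pair of monomials can contribute to \<open>P + Q\<close>, the product formula has a single term. The
  criterion is applied to greatest monomials, to least monomials and to single variables.
\<close>

lemma coord_mult_unique_split:
  assumes x: "x \<in> carrier A" and y: "y \<in> carrier A"
    and unique: "\<And>M N. coord x M \<noteq> 0 \<Longrightarrow> coord y N \<noteq> 0 \<Longrightarrow> M + N = P + Q \<Longrightarrow> M = P \<and> N = Q"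
  shows "coord (x \<otimes> y) (P + Q) = twist q P Q * coord x P * coord y Q"
proof -
  have "coord (x \<otimes> y) (P + Q) =
      (\<Sum>p\<in>{(M, N). M + N = P + Q}. if p = (P, Q) then twist q P Q * coord x P * coord y Q else 0)"
    unfolding coord_mult [OF x y] using unique by (intro sum.cong) auto
  then show ?thesis by (simp add: finite_multiset_splits)
qed

text \<open>
  What matters about the order of multisets is that it is total, that it is compatible with addition
  and that the empty multiset, the exponent of the constants, is its least element.
\<close>

definition lead :: "(nat list \<Rightarrow> 'a) set \<Rightarrow> nat multiset" where
  "lead x = Max {M. coord x M \<noteq> 0}"

definition trail :: "(nat list \<Rightarrow> 'a) set \<Rightarrow> nat multiset" where
  "trail x = Min {M. coord x M \<noteq> 0}"

context
  fixes x assumes x: "x \<in> carrier A" "x \<noteq> \<zero>"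
begin

lemma coord_lead: "coord x (lead x) \<noteq> 0"
  using Max_in [OF coord_finite [OF x(1)] coord_nonzero [OF x]] by (simp add: lead_def)

lemma coord_trail: "coord x (trail x) \<noteq> 0"
  using Min_in [OF coord_finite [OF x(1)] coord_nonzero [OF x]] by (simp add: trail_def)

lemma lead_ge: "coord x M \<noteq> 0 \<Longrightarrow> M \<le> lead x"
  using Max_ge [OF coord_finite [OF x(1)]] by (simp add: lead_def)

lemma trail_le: "coord x M \<noteq> 0 \<Longrightarrow> trail x \<le> M"
  using Min_le [OF coord_finite [OF x(1)]] by (simp add: trail_def)

end

lemma add_eq_extreme:
  fixes M N P Q :: "nat multiset"
  assumes "M + N = P + Q"
  shows "M \<le> P \<Longrightarrow> N \<le> Q \<Longrightarrow> M = P \<and> N = Q" and "P \<le> M \<Longrightarrow> Q \<le> N \<Longrightarrow> M = P \<and> N = Q"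
  using assms add_less_le_mono [of M P N Q] add_le_less_mono [of M P N Q]
    add_less_le_mono [of P M Q N] add_le_less_mono [of P M Q N]
  by (auto simp: order.order_iff_strict)

context
  fixes x y assumes x: "x \<in> carrier A" "x \<noteq> \<zero>" and y: "y \<in> carrier A" "y \<noteq> \<zero>"
begin

lemma coord_mult_lead: "coord (x \<otimes> y) (lead x + lead y) \<noteq> 0"
proof -
  have "coord (x \<otimes> y) (lead x + lead y) = twist q (lead x) (lead y) * coord x (lead x) * coord y (lead y)"
    using x y lead_ge by (intro coord_mult_unique_split add_eq_extreme(1)) auto
  then show ?thesis
    using twist_nonzero [OF coord_support coord_support, of x "lead x" y "lead y"]
      coord_lead [OF x] coord_lead [OF y] x y by simp
qed

lemma coord_mult_trail: "coord (x \<otimes> y) (trail x + trail y) \<noteq> 0"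
proof -
  have "coord (x \<otimes> y) (trail x + trail y) =
      twist q (trail x) (trail y) * coord x (trail x) * coord y (trail y)"
    using x y trail_le by (intro coord_mult_unique_split add_eq_extreme(2)) auto
  then show ?thesis
    using twist_nonzero [OF coord_support coord_support, of x "trail x" y "trail y"]
      coord_trail [OF x] coord_trail [OF y] x y by simp
qed

lemma mult_nonzero: "x \<otimes> y \<noteq> \<zero>"
  using coord_mult_lead by auto

lemma lead_mult: "lead (x \<otimes> y) = lead x + lead y"
proof (rule order.antisym)
  have xy: "x \<otimes> y \<in> carrier A" using x y by simp
  obtain M N where "lead (x \<otimes> y) = M + N" "coord x M \<noteq> 0" "coord y N \<noteq> 0"
    using coord_mult_split [OF x(1) y(1) coord_lead [OF xy mult_nonzero]] .
  then show "lead (x \<otimes> y) \<le> lead x + lead y"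
    using lead_ge [OF x] lead_ge [OF y] by (simp add: add_mono)
  show "lead x + lead y \<le> lead (x \<otimes> y)"
    using lead_ge [OF xy mult_nonzero] coord_mult_lead by simp
qed

lemma trail_mult: "trail (x \<otimes> y) = trail x + trail y"
proof (rule order.antisym)
  have xy: "x \<otimes> y \<in> carrier A" using x y by simp
  obtain M N where "trail (x \<otimes> y) = M + N" "coord x M \<noteq> 0" "coord y N \<noteq> 0"
    using coord_mult_split [OF x(1) y(1) coord_trail [OF xy mult_nonzero]] .
  then show "trail x + trail y \<le> trail (x \<otimes> y)"
    using trail_le [OF x] trail_le [OF y] by (simp add: add_mono)
  show "trail (x \<otimes> y) \<le> trail x + trail y"
    using trail_le [OF xy mult_nonzero] coord_mult_trail by simp
qed

end

lemma X_nonzero: "i \<in> {1..n} \<Longrightarrow> X i \<noteq> \<zero>"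
  using coord_X [of i "{#i#}"] by auto

lemma one_nonzero: "\<one> \<noteq> \<zero>"
  using coord_const [of 1 "{#}"] by auto

text \<open>
  Quantum affine space has no zero divisors, so a nonzero element determines its scalar factor.
\<close>

lemma scal_inject:
  assumes "q_const n q c \<otimes> x = q_const n q d \<otimes> x" "x \<in> carrier A" "x \<noteq> \<zero>"
  shows "c = d"
proof -
  have "q_const n q (c - d) \<otimes> x = \<zero>"
    using assms scal_add [of c "- d"] by (simp add: l_distr scal_minus l_minus r_neg)
  then have "q_const n q (c - d) = \<zero>"
    using mult_nonzero [of "q_const n q (c - d)" x] assms by auto
  then show ?thesis using coord_const [of "c - d" "{#}"] by simp
qed

text \<open>
  Elements commuting with \<open>z\<close> up to a scalar are closed under products, and the scalars multiply. All
  commutation rules for monomials come from here.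
\<close>

lemma skew_mult:
  assumes "x \<in> carrier A" "y \<in> carrier A" "z \<in> carrier A"
    and "x \<otimes> z = q_const n q c \<otimes> (z \<otimes> x)" "y \<otimes> z = q_const n q d \<otimes> (z \<otimes> y)"
  shows "(x \<otimes> y) \<otimes> z = q_const n q (c * d) \<otimes> (z \<otimes> (x \<otimes> y))"
proof -
  have "(x \<otimes> y) \<otimes> z = x \<otimes> (q_const n q d \<otimes> (z \<otimes> y))"
    using assms(1-3,5) by (simp add: m_assoc)
  also have "\<dots> = q_const n q d \<otimes> ((x \<otimes> z) \<otimes> y)"
    using assms(1-3) scal_left_commute [of x "z \<otimes> y" d] by (simp add: m_assoc)
  also have "\<dots> = q_const n q d \<otimes> (q_const n q c \<otimes> (z \<otimes> (x \<otimes> y)))"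
    using assms(1-4) by (simp add: m_assoc)
  finally show ?thesis using assms(1-3) by (simp add: scal_scal mult.commute)
qed

lemma skew_swap:
  assumes "x \<in> carrier A" "y \<in> carrier A" "x \<otimes> y = q_const n q c \<otimes> (y \<otimes> x)" "d * c = 1"
  shows "y \<otimes> x = q_const n q d \<otimes> (x \<otimes> y)"
  using assms by (simp add: scal_scal)

lemma X_pow_skew:
  assumes "k \<in> {1..n}" "j \<in> {1..n}"
  shows "(X k [^] m) \<otimes> X j = q_const n q (q k j ^ m) \<otimes> (X j \<otimes> (X k [^] (m :: nat)))"
proof (induction m)
  case (Suc m)
  show ?case
    using skew_mult [OF _ _ _ Suc X_commute [OF assms]] assms by (simp add: mult.commute)
qed (use assms in simp)

lemma X_pow_nonzero: "k \<in> {1..n} \<Longrightarrow> X k [^] (m :: nat) \<noteq> \<zero>"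
  by (induction m) (simp_all add: one_nonzero mult_nonzero X_nonzero)

text \<open>
  The monomial \<open>X\<^sup>\<nu>\<close> restricted to the variables in a list, which allows induction on the number of
  factors.
\<close>

definition list_monom :: "(nat \<Rightarrow> nat) \<Rightarrow> nat list \<Rightarrow> (nat list \<Rightarrow> 'a) set" where
  "list_monom \<nu> ks = foldr (\<lambda>k m. (X k [^] \<nu> k) \<otimes> m) ks \<one>"

lemma list_monom:
  assumes "set ks \<subseteq> {1..n}"
  shows list_monom_closed: "list_monom \<nu> ks \<in> carrier A"
    and list_monom_nonzero: "list_monom \<nu> ks \<noteq> \<zero>"
    and list_monom_skew: "j \<in> {1..n} \<Longrightarrow> list_monom \<nu> ks \<otimes> X j =
      q_const n q (prod_list (map (\<lambda>k. q k j ^ \<nu> k) ks)) \<otimes> (X j \<otimes> list_monom \<nu> ks)"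
  using assms
proof (induction ks)
  case Nil
  { case 1 then show ?case by (simp add: list_monom_def)
  next case 2 then show ?case by (simp add: list_monom_def one_nonzero)
  next case 3 then show ?case by (simp add: list_monom_def)
  }
next
  case (Cons k ks)
  { case 1 then show ?case using Cons by (simp add: list_monom_def)
  next case 2 then show ?case using Cons by (simp add: list_monom_def mult_nonzero X_pow_nonzero)
  next
    case 3
    then have "k \<in> {1..n}" "list_monom \<nu> ks \<in> carrier A" using Cons by auto
    then show ?case
      using skew_mult [OF _ _ _ X_pow_skew [of k j "\<nu> k"] Cons.IH(3)] 3 by (simp add: list_monom_def)
  }
qed

lemma monom_list: "q_monom n q \<nu> = list_monom \<nu> [1..<Suc n]"
  unfolding q_monom_def A_eq [symmetric] list_monom_def ..

lemma set_indices: "set [1..<Suc n] = {1..n}"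
  by auto

lemma monom_closed: "q_monom n q \<nu> \<in> carrier A"
  unfolding monom_list by (rule list_monom_closed) (simp only: set_indices subset_refl)

lemma monom_nonzero: "q_monom n q \<nu> \<noteq> \<zero>"
  unfolding monom_list by (rule list_monom_nonzero) (simp only: set_indices subset_refl)

lemma monom_skew:
  assumes "j \<in> {1..n}"
  shows "q_monom n q \<nu> \<otimes> X j =
    q_const n q (\<Prod>k\<in>{1..n}. q k j ^ \<nu> k) \<otimes> (X j \<otimes> q_monom n q \<nu>)"
proof -
  have "prod_list (map (\<lambda>k. q k j ^ \<nu> k) [1..<Suc n]) = (\<Prod>k\<in>{1..n}. q k j ^ \<nu> k)"
    using prod.distinct_set_conv_list [of "[1..<Suc n]" "\<lambda>k. q k j ^ \<nu> k"]
    by (simp only: set_indices distinct_upt)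
  then show ?thesis
    using list_monom_skew [of "[1..<Suc n]" j \<nu>] assms by (simp only: monom_list set_indices subset_refl)
qed

lemma Lambda_monom_skew:
  assumes "\<nu> \<in> Lambda n q i" "j \<in> {1..n}" "j \<noteq> i"
  shows "q_monom n q \<nu> \<otimes> X j = q_const n q (q i j) \<otimes> (X j \<otimes> q_monom n q \<nu>)"
  using assms monom_skew [of j \<nu>] by (simp add: Lambda_def)

lemma Lambda_monom_skew':
  assumes "\<nu> \<in> Lambda n q i" "i \<in> {1..n}" "j \<in> {1..n}" "j \<noteq> i"
  shows "X j \<otimes> q_monom n q \<nu> = q_const n q (q j i) \<otimes> (q_monom n q \<nu> \<otimes> X j)"
  using skew_swap [OF monom_closed X_closed Lambda_monom_skew] assms q_swap by blast

end

section \<open>Derivations\<close>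

text \<open>
  The ring \<open>R[\<epsilon>]\<close> with \<open>\<epsilon>\<^sup>2 = 0\<close>; the pair \<open>(x, y)\<close> stands for \<open>x + \<epsilon> y\<close>. A map \<open>D\<close> is a derivation if
  and only if \<open>x \<mapsto> x + \<epsilon> D x\<close> is a ring homomorphism, so that the universal property also yields
  derivations.
\<close>

definition dual_numbers :: "('b, 'm) ring_scheme \<Rightarrow> ('b \<times> 'b) ring" where
  "dual_numbers R =
    \<lparr>carrier = carrier R \<times> carrier R,
     monoid.mult = (\<lambda>x y. (fst x \<otimes>\<^bsub>R\<^esub> fst y, fst x \<otimes>\<^bsub>R\<^esub> snd y \<oplus>\<^bsub>R\<^esub> snd x \<otimes>\<^bsub>R\<^esub> fst y)),
     monoid.one = (\<one>\<^bsub>R\<^esub>, \<zero>\<^bsub>R\<^esub>),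
     ring.zero = (\<zero>\<^bsub>R\<^esub>, \<zero>\<^bsub>R\<^esub>),
     ring.add = (\<lambda>x y. (fst x \<oplus>\<^bsub>R\<^esub> fst y, snd x \<oplus>\<^bsub>R\<^esub> snd y))\<rparr>"

lemma (in scalar_algebra) dual_numbers_scalar_algebra:
  "scalar_algebra (dual_numbers B) (\<lambda>c. (scal c, \<zero>))"
proof (intro scalar_algebra.intro scalar_algebra_axioms.intro ringI abelian_groupI monoidI)
  fix x assume "x \<in> carrier (dual_numbers B)"
  then show "\<exists>y\<in>carrier (dual_numbers B). y \<oplus>\<^bsub>dual_numbers B\<^esub> x = \<zero>\<^bsub>dual_numbers B\<^esub>"
    by (intro bexI [of _ "(\<ominus> fst x, \<ominus> snd x)"]) (auto simp: dual_numbers_def l_neg)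
next
  fix x c assume "x \<in> carrier (dual_numbers B)"
  then show "x \<otimes>\<^bsub>dual_numbers B\<^esub> (scal c, \<zero>) = (scal c, \<zero>) \<otimes>\<^bsub>dual_numbers B\<^esub> x"
    using scal_central [of "fst x" c] scal_central [of "snd x" c]
    by (auto simp: dual_numbers_def)
qed (auto simp: dual_numbers_def l_distr r_distr a_ac m_assoc scal_add scal_mult)

context quantum_space
begin

lemma derivationD:
  assumes "D \<in> q_derivations n q"
  shows "D \<in> carrier A \<rightarrow>\<^sub>E carrier A"
    and "x \<in> carrier A \<Longrightarrow> y \<in> carrier A \<Longrightarrow> D (x \<oplus> y) = D x \<oplus> D y"
    and "x \<in> carrier A \<Longrightarrow> y \<in> carrier A \<Longrightarrow> D (x \<otimes> y) = D x \<otimes> y \<oplus> x \<otimes> D y"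
    and "x \<in> carrier A \<Longrightarrow> D (q_const n q c \<otimes> x) = q_const n q c \<otimes> D x"
  using assms unfolding q_derivations_def q_scale_const A_eq [symmetric] by blast+

lemma derivation_const:
  assumes "D \<in> q_derivations n q"
  shows "D (q_const n q c) = \<zero>"
proof -
  have D: "D \<one> \<in> carrier A" using derivationD(1) [OF assms] by auto
  have "D \<one> \<oplus> D \<one> = D \<one>" using D derivationD(3) [OF assms, of \<one> \<one>] by simp
  then have "D \<one> = \<zero>" using D by (simp add: add.l_cancel_one)
  then show ?thesis using derivationD(4) [OF assms, of \<one> c] by simp
qed

lemma derivation_unique:
  assumes D: "D \<in> q_derivations n q" and D': "D' \<in> q_derivations n q"
    and eq: "\<And>i. i \<in> {1..n} \<Longrightarrow> D (X i) = D' (X i)"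
  shows "D = D'"
proof (rule PiE_ext [OF derivationD(1) [OF D] derivationD(1) [OF D']])
  fix x assume "x \<in> carrier A"
  then show "D x = D' x"
    by (induction x rule: q_space_induct)
       (simp_all add: derivation_const D D' eq derivationD(2,3) [OF D] derivationD(2,3) [OF D'])
qed

text \<open>
  Lift \<open>X\<^sub>i \<mapsto> X\<^sub>i + \<epsilon> X\<^sup>\<nu>\<close>, with the other variables fixed, to the dual numbers. The defining relations
  hold because \<open>X\<^sup>\<nu>\<close> commutes with the other variables in the way \<open>X\<^sub>i\<close> does.
\<close>

lemma derivation_exists:
  assumes "i \<in> {1..n}" "\<nu> \<in> Lambda n q i"
  shows "\<exists>D\<in>q_derivations n q. \<forall>j\<in>{1..n}. D (X j) = (if j = i then q_monom n q \<nu> else \<zero>)"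
proof -
  interpret dual: scalar_algebra "dual_numbers A" "\<lambda>c. (q_const n q c, \<zero>)"
    by (rule dual_numbers_scalar_algebra)
  let ?m = "q_monom n q \<nu>"
  define b where "b j = (X j, if j = i then ?m else \<zero>)" for j
  have b: "b \<in> {1..n} \<rightarrow> carrier (dual_numbers A)"
    by (auto simp: b_def dual_numbers_def monom_closed)
  have rel: "b j \<otimes>\<^bsub>dual_numbers A\<^esub> b k =
      (q_const n q (q j k), \<zero>) \<otimes>\<^bsub>dual_numbers A\<^esub> (b k \<otimes>\<^bsub>dual_numbers A\<^esub> b j)"
    if "1 \<le> j" "j < k" "k \<le> n" for j k
  proof -
    have jk: "j \<in> {1..n}" "k \<in> {1..n}" using that by auto
    have "X j \<otimes> snd (b k) \<oplus> snd (b j) \<otimes> X k =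
        q_const n q (q j k) \<otimes> (X k \<otimes> snd (b j) \<oplus> snd (b k) \<otimes> X j)"
      using that jk assms Lambda_monom_skew [OF assms(2), of k] Lambda_monom_skew' [OF assms(2), of j]
      by (auto simp: b_def monom_closed)
    then show ?thesis
      using jk X_commute [OF jk] by (simp add: dual_numbers_def b_def monom_closed)
  qed
  let ?h = "dual.q_lift b"
  have hom: "?h \<in> ring_hom A (dual_numbers A)"
    using dual.q_lift_hom [OF b rel] by (simp add: A_eq)
  have X: "?h (X j) = b j" if "j \<in> {1..n}" for j
    using dual.q_lift_var [OF b rel that] by simp
  have c: "?h (q_const n q c) = (q_const n q c, \<zero>)" for c
    by (rule dual.q_lift_const [OF b rel])
  have closed: "?h x \<in> carrier A \<times> carrier A" if "x \<in> carrier A" for x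
    using ring_hom_closed [OF hom that] by (simp add: dual_numbers_def)
  have mult: "?h (x \<otimes> y) = (fst (?h x) \<otimes> fst (?h y), fst (?h x) \<otimes> snd (?h y) \<oplus> snd (?h x) \<otimes> fst (?h y))"
    if "x \<in> carrier A" "y \<in> carrier A" for x y
    using ring_hom_mult [OF hom that] by (simp add: dual_numbers_def)
  have add: "?h (x \<oplus> y) = (fst (?h x) \<oplus> fst (?h y), snd (?h x) \<oplus> snd (?h y))"
    if "x \<in> carrier A" "y \<in> carrier A" for x y
    using ring_hom_add [OF hom that] by (simp add: dual_numbers_def)
  have fst_b: "fst (b j) = X j" for j by (simp add: b_def)
  have fst: "fst (?h x) = x" if "x \<in> carrier A" for x
    using that by (induction x rule: q_space_induct) (simp_all add: c X fst_b mult add)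
  define D where "D = (\<lambda>x\<in>carrier A. snd (?h x))"
  have snd: "snd (?h x) \<in> carrier A" if "x \<in> carrier A" for x
    using closed [OF that] by (simp add: mem_Times_iff)
  have "D \<in> q_derivations n q"
    unfolding q_derivations_def q_scale_const A_eq [symmetric]
    by (auto simp: D_def snd fst add mult c a_comm)
  moreover have "D (X j) = (if j = i then ?m else \<zero>)" if "j \<in> {1..n}" for j
    using that by (simp add: D_def X) (simp add: b_def)
  ultimately show ?thesis by blast
qed

text \<open>
  Existence and uniqueness make the definite description meaningful.
\<close>

lemma q_D:
  assumes "i \<in> {1..n}" "\<nu> \<in> Lambda n q i"
  shows "q_D n q i \<nu> \<in> q_derivations n q"
    and "j \<in> {1..n} \<Longrightarrow> q_D n q i \<nu> (X j) = (if j = i then q_monom n q \<nu> else \<zero>)"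
proof -
  let ?P = "\<lambda>D. D \<in> q_derivations n q \<and>
    (\<forall>j\<in>{1..n}. D (X j) = (if j = i then q_monom n q \<nu> else \<zero>))"
  have "\<exists>!D. ?P D"
  proof (rule ex_ex1I)
    show "\<exists>D. ?P D" using derivation_exists [OF assms] by blast
  next
    fix D D' assume "?P D" "?P D'"
    then show "D = D'" by (intro derivation_unique) auto
  qed
  then have "?P (THE D. ?P D)" by (rule theI')
  then show "q_D n q i \<nu> \<in> q_derivations n q"
    and "j \<in> {1..n} \<Longrightarrow> q_D n q i \<nu> (X j) = (if j = i then q_monom n q \<nu> else \<zero>)"
    unfolding q_D_def A_eq by blast+
qed

text \<open>
  An exponent \<open>\<nu> \<in> \<Lambda>\<^sub>i\<close> gives a nonzero element of \<open>E\<close>, as \<open>D\<^sub>i\<^sub>\<nu>(X\<^sub>i) = X\<^sup>\<nu> \<noteq> 0\<close>; without exponents only the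
  empty sum remains.
\<close>

lemma E_zero_iff: "q_E n q = {q_zero_map n q} \<longleftrightarrow> (\<forall>i\<in>{1..n}. Lambda n q i = {})"
proof
  assume E: "q_E n q = {q_zero_map n q}"
  show "\<forall>i\<in>{1..n}. Lambda n q i = {}"
  proof (intro ballI equals0I)
    fix i \<nu> assume i: "i \<in> {1..n}" and \<nu>: "\<nu> \<in> Lambda n q i"
    let ?D = "\<lambda>x\<in>carrier A. finsum A (\<lambda>(i, \<nu>). \<one> \<otimes> q_D n q i \<nu> x) {(i, \<nu>)}"
    have "?D \<in> q_E n q"
      unfolding q_E_def A_eq [symmetric] using i \<nu>
      by (intro CollectI exI [of _ "\<lambda>i \<nu>. \<one>"] exI [of _ "{(i, \<nu>)}"]) auto
    then have "?D = q_zero_map n q" unfolding E by (rule singletonD)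
    then have "?D (X i) = q_zero_map n q (X i)" by (rule fun_cong)
    moreover have "?D (X i) = q_monom n q \<nu>"
      using i q_D(2) [OF i \<nu> i] monom_closed by simp
    ultimately show False
      using i monom_nonzero [of \<nu>] by (simp add: q_zero_map_def flip: A_eq)
  qed
next
  assume "\<forall>i\<in>{1..n}. Lambda n q i = {}"
  then have "Sigma {1..n} (Lambda n q) = {}" by blast
  then show "q_E n q = {q_zero_map n q}"
    unfolding q_E_def q_zero_map_def A_eq [symmetric] by auto
qed

end

section \<open>Construction of automorphisms\<close>

context quantum_space
begin

definition alg_end :: "((nat list \<Rightarrow> 'a) set \<Rightarrow> (nat list \<Rightarrow> 'a) set) \<Rightarrow> bool" where
  "alg_end h \<longleftrightarrow> h \<in> ring_hom A A \<and> (\<forall>c. h (q_const n q c) = q_const n q c)"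

lemma alg_endI:
  assumes "\<And>x. x \<in> carrier A \<Longrightarrow> h x \<in> carrier A"
    and "\<And>x y. x \<in> carrier A \<Longrightarrow> y \<in> carrier A \<Longrightarrow> h (x \<oplus> y) = h x \<oplus> h y"
    and "\<And>x y. x \<in> carrier A \<Longrightarrow> y \<in> carrier A \<Longrightarrow> h (x \<otimes> y) = h x \<otimes> h y"
    and "\<And>c. h (q_const n q c) = q_const n q c"
  shows "alg_end h"
  unfolding alg_end_def using assms assms(4) [of 1] by (auto intro: ring_hom_memI)

lemma alg_endD:
  assumes "alg_end h"
  shows alg_end_closed: "x \<in> carrier A \<Longrightarrow> h x \<in> carrier A"
    and alg_end_add: "x \<in> carrier A \<Longrightarrow> y \<in> carrier A \<Longrightarrow> h (x \<oplus> y) = h x \<oplus> h y"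
    and alg_end_mult: "x \<in> carrier A \<Longrightarrow> y \<in> carrier A \<Longrightarrow> h (x \<otimes> y) = h x \<otimes> h y"
    and alg_end_const: "h (q_const n q c) = q_const n q c"
  using assms unfolding alg_end_def by (auto simp: ring_hom_def)

lemma alg_end_one: "alg_end h \<Longrightarrow> h \<one> = \<one>"
  using alg_end_const [of h 1] by simp

lemma alg_end_pow: "alg_end h \<Longrightarrow> x \<in> carrier A \<Longrightarrow> h (x [^] (m :: nat)) = h x [^] m"
  by (induction m) (simp_all add: alg_end_one alg_end_mult)

lemma alg_end_eqI:
  assumes "alg_end f" "alg_end g" "\<And>i. i \<in> {1..n} \<Longrightarrow> f (X i) = g (X i)" "x \<in> carrier A"
  shows "f x = g x"
  using assms(4)
  by (induction x rule: q_space_induct)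
     (simp_all add: assms(3) alg_endD [OF assms(1)] alg_endD [OF assms(2)])

lemma alg_end_comp: "alg_end f \<Longrightarrow> alg_end g \<Longrightarrow> alg_end (\<lambda>x. f (g x))"
  by (rule alg_endI) (simp_all add: alg_end_closed alg_end_add alg_end_mult alg_end_const)

lemma alg_end_id: "alg_end (\<lambda>x. x)"
  by (rule alg_endI) simp_all

lemma alg_end_lift:
  assumes b: "b \<in> {1..n} \<rightarrow> carrier A"
    and rel: "\<And>i j. i \<in> {1..n} \<Longrightarrow> j \<in> {1..n} \<Longrightarrow> i \<noteq> j \<Longrightarrow>
      b i \<otimes> b j = q_const n q (q i j) \<otimes> (b j \<otimes> b i)"
  shows "alg_end (q_lift b)" and "i \<in> {1..n} \<Longrightarrow> q_lift b (X i) = b i"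
proof -
  have rel': "b i \<otimes> b j = q_const n q (q i j) \<otimes> (b j \<otimes> b i)"
    if "1 \<le> i" "i < j" "j \<le> n" for i j
    using that by (intro rel) auto
  show "alg_end (q_lift b)"
    using q_lift_hom [OF b rel'] q_lift_const [OF b rel'] by (simp add: alg_end_def flip: A_eq)
  show "i \<in> {1..n} \<Longrightarrow> q_lift b (X i) = b i"
    using q_lift_var [OF b rel'] by simp
qed

lemma Aut_iff:
  "\<phi> \<in> q_Aut n q \<longleftrightarrow>
     \<phi> \<in> extensional (carrier A) \<and> alg_end \<phi> \<and> bij_betw \<phi> (carrier A) (carrier A)"
proof
  assume \<phi>: "\<phi> \<in> q_Aut n q"
  then have hom: "\<phi> \<in> ring_hom A A" "bij_betw \<phi> (carrier A) (carrier A)" "\<phi> \<in> extensional (carrier A)"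
    and scale: "\<And>c x. x \<in> carrier A \<Longrightarrow> \<phi> (q_const n q c \<otimes> x) = q_const n q c \<otimes> \<phi> x"
    unfolding q_Aut_def q_scale_const A_eq [symmetric] ring_iso_def by blast+
  have "\<phi> (q_const n q c) = q_const n q c" for c
    using scale [of \<one> c] ring_hom_one [OF hom(1)] by simp
  then show "\<phi> \<in> extensional (carrier A) \<and> alg_end \<phi> \<and> bij_betw \<phi> (carrier A) (carrier A)"
    using hom by (simp add: alg_end_def)
next
  assume "\<phi> \<in> extensional (carrier A) \<and> alg_end \<phi> \<and> bij_betw \<phi> (carrier A) (carrier A)"
  then show "\<phi> \<in> q_Aut n q"
    unfolding q_Aut_def q_scale_const A_eq [symmetric] ring_iso_def
    by (auto simp: alg_end_mult alg_end_const) (simp add: alg_end_def)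
qed

lemma Aut_alg_end: "\<phi> \<in> q_Aut n q \<Longrightarrow> alg_end \<phi>"
  by (simp add: Aut_iff)

text \<open>
  Homomorphisms that are inverse to each other on the variables are inverse to each other, since the
  variables generate.
\<close>

lemma Aut_from_inverse:
  assumes f: "alg_end f" and g: "alg_end g"
    and fg: "\<And>i. i \<in> {1..n} \<Longrightarrow> f (g (X i)) = X i"
    and gf: "\<And>i. i \<in> {1..n} \<Longrightarrow> g (f (X i)) = X i"
  shows "restrict f (carrier A) \<in> q_Aut n q"
proof -
  have "f (g x) = x" "g (f x) = x" if "x \<in> carrier A" for x
    using alg_end_eqI [OF alg_end_comp [OF f g] alg_end_id fg that]
      alg_end_eqI [OF alg_end_comp [OF g f] alg_end_id gf that] by auto
  then have "bij_betw f (carrier A) (carrier A)"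
    by (intro bij_betw_byWitness [of _ g]) (auto simp: alg_end_closed f g)
  then have "bij_betw (restrict f (carrier A)) (carrier A) (carrier A)"
    by (simp cong: bij_betw_cong)
  moreover have "alg_end (restrict f (carrier A))"
    by (rule alg_endI) (simp_all add: alg_endD [OF f])
  ultimately show ?thesis by (simp add: Aut_iff)
qed

lemma Aut_inverse:
  assumes "\<phi> \<in> q_Aut n q"
  obtains \<psi> where "\<psi> \<in> q_Aut n q" "\<And>x. x \<in> carrier A \<Longrightarrow> \<psi> (\<phi> x) = x"
    "\<And>x. x \<in> carrier A \<Longrightarrow> \<phi> (\<psi> x) = x"
proof
  have \<phi>: "alg_end \<phi>" "bij_betw \<phi> (carrier A) (carrier A)" using assms by (auto simp: Aut_iff)
  let ?\<psi> = "restrict (inv_into (carrier A) \<phi>) (carrier A)"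
  show inv: "\<And>x. x \<in> carrier A \<Longrightarrow> ?\<psi> (\<phi> x) = x"
    using \<phi> by (simp add: alg_end_closed bij_betw_inv_into_left)
  show "\<And>x. x \<in> carrier A \<Longrightarrow> \<phi> (?\<psi> x) = x"
    using \<phi> by (simp add: bij_betw_inv_into_right)
  have "inv_into (carrier A) \<phi> \<in> ring_iso A A"
    using \<phi> by (intro ring_iso_set_sym ring_axioms) (simp add: ring_iso_def alg_end_def)
  then have "inv_into (carrier A) \<phi> \<in> ring_hom A A" "bij_betw (inv_into (carrier A) \<phi>) (carrier A) (carrier A)"
    by (auto simp: ring_iso_def)
  moreover have "inv_into (carrier A) \<phi> (q_const n q c) = q_const n q c" for c
    using inv [of "q_const n q c"] \<phi>(1) by (simp add: alg_end_const)
  ultimately show "?\<psi> \<in> q_Aut n q"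
    by (auto simp: Aut_iff alg_end_def ring_hom_def cong: bij_betw_cong)
qed

lemma permutation_Aut:
  assumes \<sigma>: "\<sigma> permutes {1..n}"
    and sym: "\<And>i j. i \<in> {1..n} \<Longrightarrow> j \<in> {1..n} \<Longrightarrow> q (\<sigma> i) (\<sigma> j) = q i j"
  shows "\<exists>\<phi>\<in>q_Aut n q. \<forall>i\<in>{1..n}. \<phi> (X i) = X (\<sigma> i)"
proof -
  let ?\<tau> = "inv_into UNIV \<sigma>"
  have \<tau>: "?\<tau> permutes {1..n}" using \<sigma> by (rule permutes_inv)
  have \<sigma>\<tau>: "\<sigma> (?\<tau> i) = i" "?\<tau> (\<sigma> i) = i" for i
    using permutes_inverses [OF \<sigma>] by auto
  have sym': "q (?\<tau> i) (?\<tau> j) = q i j" if "i \<in> {1..n}" "j \<in> {1..n}" for i j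
    using sym [of "?\<tau> i" "?\<tau> j"] that by (simp only: \<sigma>\<tau> permutes_in_image [OF \<tau>])
  have lift: "alg_end (q_lift (\<lambda>i. X (\<rho> i)))" "i \<in> {1..n} \<Longrightarrow> q_lift (\<lambda>i. X (\<rho> i)) (X i) = X (\<rho> i)"
    if \<rho>: "\<rho> permutes {1..n}" and \<rho>q: "\<And>i j. i \<in> {1..n} \<Longrightarrow> j \<in> {1..n} \<Longrightarrow> q (\<rho> i) (\<rho> j) = q i j"
    for \<rho> i
  proof -
    have in_range: "\<rho> i \<in> {1..n}" if "i \<in> {1..n}" for i
      using that by (simp only: permutes_in_image [OF \<rho>])
    have closed: "(\<lambda>i. X (\<rho> i)) \<in> {1..n} \<rightarrow> carrier A"
      using X_closed in_range by blast
    have rel: "X (\<rho> i) \<otimes> X (\<rho> j) = q_const n q (q i j) \<otimes> (X (\<rho> j) \<otimes> X (\<rho> i))"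
      if "i \<in> {1..n}" "j \<in> {1..n}" for i j
      using X_commute [OF in_range in_range, OF that] by (simp only: \<rho>q [OF that])
    show "alg_end (q_lift (\<lambda>i. X (\<rho> i)))"
      by (rule alg_end_lift(1) [OF closed rel])
    show "i \<in> {1..n} \<Longrightarrow> q_lift (\<lambda>i. X (\<rho> i)) (X i) = X (\<rho> i)"
      using alg_end_lift(2) [OF closed rel] by blast
  qed
  let ?f = "q_lift (\<lambda>i. X (\<sigma> i))" and ?g = "q_lift (\<lambda>i. X (?\<tau> i))"
  have "restrict ?f (carrier A) \<in> q_Aut n q"
  proof (rule Aut_from_inverse [of _ ?g])
    fix i assume i: "i \<in> {1..n}"
    then have "\<sigma> i \<in> {1..n}" "?\<tau> i \<in> {1..n}"
      by (simp_all only: permutes_in_image [OF \<sigma>] permutes_in_image [OF \<tau>])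
    then show "?f (?g (X i)) = X i" "?g (?f (X i)) = X i"
      using i by (simp_all only: lift(2) [OF \<sigma> sym] lift(2) [OF \<tau> sym'] \<sigma>\<tau>)
  qed (rule lift(1) [OF \<sigma> sym] lift(1) [OF \<tau> sym'], assumption+)+
  moreover have "restrict ?f (carrier A) (X i) = X (\<sigma> i)" if "i \<in> {1..n}" for i
    using lift(2) [OF \<sigma> sym that] that by simp
  ultimately show ?thesis by blast
qed

lemma alg_end_fixes_monom:
  assumes h: "alg_end h" and fixed: "\<And>k. k \<in> {1..n} \<Longrightarrow> \<nu> k \<noteq> 0 \<Longrightarrow> h (X k) = X k"
  shows "h (q_monom n q \<nu>) = q_monom n q \<nu>"
proof -
  have "h (list_monom \<nu> ks) = list_monom \<nu> ks" if "set ks \<subseteq> {1..n}" for ks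
    using that
  proof (induction ks)
    case Nil
    then show ?case using h by (simp add: list_monom_def alg_end_one)
  next
    case (Cons k ks)
    have k: "k \<in> {1..n}" using Cons.prems by simp
    have closed: "list_monom \<nu> ks \<in> carrier A" using Cons.prems by (intro list_monom_closed) auto
    have "h (X k [^] \<nu> k) = X k [^] \<nu> k"
      using k fixed [OF k] by (cases "\<nu> k = 0") (simp_all add: alg_end_pow [OF h] alg_end_one [OF h])
    then show ?case
      using Cons k closed alg_end_mult [OF h, of "X k [^] \<nu> k" "list_monom \<nu> ks"]
      by (simp add: list_monom_def)
  qed
  then show ?thesis
    unfolding monom_list by (simp only: set_indices subset_refl)
qed

text \<open>
  The parameter \<open>c\<close> lets the shear \<open>X\<^sub>i \<mapsto> X\<^sub>i + X\<^sup>\<nu>\<close> and its inverse \<open>X\<^sub>i \<mapsto> X\<^sub>i - X\<^sup>\<nu>\<close> be treated together.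
\<close>

lemma shear_lift:
  assumes i: "i \<in> {1..n}" and \<nu>: "\<nu> \<in> Lambda n q i"
  defines "b \<equiv> \<lambda>c j. if j = i then X i \<oplus> q_const n q c \<otimes> q_monom n q \<nu> else X j"
  shows "alg_end (q_lift (b c))" and "j \<in> {1..n} \<Longrightarrow> q_lift (b c) (X j) = b c j"
    and "q_lift (b c) (q_monom n q \<nu>) = q_monom n q \<nu>"
proof -
  let ?m = "q_monom n q \<nu>"
  note m = monom_closed [of \<nu>]
  define u where "u = q_const n q c \<otimes> ?m"
  have u: "u \<in> carrier A" using m by (simp add: u_def)
  have b_eq: "b c j = (if j = i then X i \<oplus> u else X j)" for j by (simp add: b_def u_def)
  have b: "b c \<in> {1..n} \<rightarrow> carrier A"
    using i u by (auto simp: b_eq)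
  have u_skew: "u \<otimes> X k = q_const n q (q i k) \<otimes> (X k \<otimes> u)" if k: "k \<in> {1..n}" "k \<noteq> i" for k
  proof -
    have "q_const n q c \<otimes> X k = q_const n q 1 \<otimes> (X k \<otimes> q_const n q c)"
      using k by (simp add: scal_central)
    from skew_mult [OF scal_closed m X_closed [OF k(1)] this Lambda_monom_skew [OF \<nu> k]]
    show ?thesis by (simp add: u_def)
  qed
  have rel: "b c j \<otimes> b c k = q_const n q (q j k) \<otimes> (b c k \<otimes> b c j)"
    if jk: "j \<in> {1..n}" "k \<in> {1..n}" "j \<noteq> k" for j k
  proof -
    consider "j = i" "k \<noteq> i" | "k = i" "j \<noteq> i" | "j \<noteq> i" "k \<noteq> i" using jk by blast
    then show ?thesis
    proof cases
      case 1
      have "(X i \<oplus> u) \<otimes> X k = X i \<otimes> X k \<oplus> u \<otimes> X k" using i u jk by (simp add: l_distr)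
      also have "\<dots> = q_const n q (q i k) \<otimes> (X k \<otimes> (X i \<oplus> u))"
        unfolding X_commute [OF i jk(2)] u_skew [OF jk(2) 1(2)] using i u jk by (simp add: r_distr)
      finally show ?thesis using 1 by (simp add: b_eq)
    next
      case 2
      have "X j \<otimes> u = q_const n q (q j i) \<otimes> (u \<otimes> X j)"
        using skew_swap [OF u X_closed u_skew [OF jk(1) 2(2)]] jk(1) i q_swap by blast
      then have "X j \<otimes> (X i \<oplus> u) =
          q_const n q (q j i) \<otimes> (X i \<otimes> X j) \<oplus> q_const n q (q j i) \<otimes> (u \<otimes> X j)"
        using i u jk X_commute [OF jk(1) i] by (simp add: r_distr)
      also have "\<dots> = q_const n q (q j i) \<otimes> ((X i \<oplus> u) \<otimes> X j)"
        using i u jk by (simp add: l_distr r_distr)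
      finally show ?thesis using 2 by (simp add: b_eq)
    next
      case 3
      then show ?thesis using X_commute [OF jk(1,2)] by (simp add: b_eq)
    qed
  qed
  show h: "alg_end (q_lift (b c))" by (rule alg_end_lift [OF b rel])
  show val: "q_lift (b c) (X j) = b c j" if "j \<in> {1..n}" for j
    using alg_end_lift(2) [OF b rel] that by simp
  show "q_lift (b c) ?m = ?m"
  proof (rule alg_end_fixes_monom [OF h])
    fix k assume "k \<in> {1..n}" "\<nu> k \<noteq> 0"
    then show "q_lift (b c) (X k) = X k" using \<nu> val [of k] by (auto simp: b_def Lambda_def)
  qed
qed

lemma shear_Aut:
  assumes i: "i \<in> {1..n}" and \<nu>: "\<nu> \<in> Lambda n q i"
  shows "\<exists>\<phi>\<in>q_Aut n q. \<phi> (X i) = X i \<oplus> q_monom n q \<nu> \<and> \<phi> (q_monom n q \<nu>) = q_monom n q \<nu>"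
proof -
  let ?m = "q_monom n q \<nu>"
  let ?h = "\<lambda>c. q_lift (\<lambda>j. if j = i then X i \<oplus> q_const n q c \<otimes> ?m else X j)"
  note m = monom_closed [of \<nu>] and h = shear_lift [OF i \<nu>]
  have inv: "?h c (?h d (X j)) = X j" if "c + d = 0" "j \<in> {1..n}" for c d j
  proof (cases "j = i")
    case True
    have "?h c (?h d (X i)) = (X i \<oplus> q_const n q c \<otimes> ?m) \<oplus> q_const n q d \<otimes> ?m"
      using i m alg_endD [OF h(1) [of c]] by (simp add: h(2,3))
    also have "\<dots> = X i \<oplus> q_const n q (c + d) \<otimes> ?m"
      using i m by (simp add: scal_add l_distr a_assoc)
    finally show ?thesis using True that i m by simp
  next
    case False
    then show ?thesis using that by (simp add: h(2))
  qed
  have "restrict (?h 1) (carrier A) \<in> q_Aut n q"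
    using inv [of 1 "-1"] inv [of "-1" 1] by (intro Aut_from_inverse [of _ "?h (-1)"] h(1)) auto
  moreover have "restrict (?h 1) (carrier A) (X i) = X i \<oplus> ?m"
    using i m h(2) [of i 1] by simp
  moreover have "restrict (?h 1) (carrier A) ?m = ?m"
    using m h(3) [of 1] by simp
  ultimately show ?thesis by blast
qed

section \<open>Rigidity of automorphisms\<close>

lemma coord_X_support: "j \<in> {1..n} \<Longrightarrow> coord (X j) M \<noteq> 0 \<Longrightarrow> M = {#j#}"
  using coord_X [of j M] by (cases "M = {#j#}") auto

lemma coord_const_support: "coord (q_const n q c) M \<noteq> 0 \<Longrightarrow> M = {#}"
  using coord_const [of c M] by (cases "M = {#}") auto

lemma coord_scal:
  assumes "x \<in> carrier A"
  shows "coord (q_const n q c \<otimes> x) M = c * coord x M"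
proof -
  have "coord (q_const n q c \<otimes> x) ({#} + M) =
      twist q {#} M * coord (q_const n q c) {#} * coord x M"
    by (rule coord_mult_unique_split) (use assms in \<open>auto dest: coord_const_support\<close>)
  then show ?thesis by (simp add: coord_const)
qed

lemma coord_mult_X:
  assumes "x \<in> carrier A" "j \<in> {1..n}"
  shows "coord (x \<otimes> X j) (add_mset j M) = twist q M {#j#} * coord x M"
proof -
  have "coord (x \<otimes> X j) (M + {#j#}) = twist q M {#j#} * coord x M * coord (X j) {#j#}"
    by (rule coord_mult_unique_split)
       (use assms in \<open>auto dest: coord_X_support [OF assms(2)]\<close>)
  then show ?thesis using assms by (simp add: coord_X)
qed

lemma coord_X_mult:
  assumes "x \<in> carrier A" "j \<in> {1..n}"
  shows "coord (X j \<otimes> x) (add_mset j M) = twist q {#j#} M * coord x M"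
proof -
  have "coord (X j \<otimes> x) ({#j#} + M) = twist q {#j#} M * coord (X j) {#j#} * coord x M"
    by (rule coord_mult_unique_split)
       (use assms in \<open>auto dest: coord_X_support [OF assms(2)]\<close>)
  then show ?thesis using assms by (simp add: coord_X)
qed

lemma lead_trail_X:
  assumes "j \<in> {1..n}"
  shows "lead (X j) = {#j#}" "trail (X j) = {#j#}"
  using coord_X_support [OF assms] coord_lead [OF X_closed X_nonzero, OF assms assms]
    coord_trail [OF X_closed X_nonzero, OF assms assms] by blast+

lemma lead_empty_const:
  assumes "x \<in> carrier A" "x \<noteq> \<zero>" "lead x = {#}"
  shows "x = q_const n q (coord x {#})"
proof (rule coord_inject)
  have "M = {#}" if "coord x M \<noteq> 0" for M
    using lead_ge [OF assms(1,2) that] assms(3) order.antisym [of M "{#}"] by simp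
  then show "coord x = coord (q_const n q (coord x {#}))"
    by (auto simp: coord_const fun_eq_iff)
qed (use assms in auto)

lemma X_normal:
  assumes "i \<in> {1..n}" "x \<in> carrier A"
  shows "\<exists>y\<in>carrier A. X i \<otimes> x = y \<otimes> X i"
  using assms(2)
proof (induction x rule: q_space_induct)
  case (const c)
  then show ?case using assms(1) scal_central [of "X i" c] by (intro bexI [of _ "q_const n q c"]) auto
next
  case (var j)
  then show ?case
    using assms(1) X_commute [of i j]
    by (intro bexI [of _ "q_const n q (q i j) \<otimes> X j"]) (auto simp: m_assoc)
next
  case (add x x')
  then obtain y y' where "y \<in> carrier A" "X i \<otimes> x = y \<otimes> X i" "y' \<in> carrier A" "X i \<otimes> x' = y' \<otimes> X i"
    by blast
  then show ?case
    using add assms(1) by (intro bexI [of _ "y \<oplus> y'"]) (auto simp: l_distr r_distr)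
next
  case (mult x x')
  then obtain y y' where y: "y \<in> carrier A" "X i \<otimes> x = y \<otimes> X i" "y' \<in> carrier A" "X i \<otimes> x' = y' \<otimes> X i"
    by blast
  have "X i \<otimes> (x \<otimes> x') = (X i \<otimes> x) \<otimes> x'" using mult assms(1) by (simp add: m_assoc)
  also have "\<dots> = y \<otimes> (X i \<otimes> x')" using y mult assms(1) by (simp add: m_assoc)
  also have "\<dots> = (y \<otimes> y') \<otimes> X i" using y assms(1) by (simp add: m_assoc)
  finally show ?case using y by blast
qed

text \<open>
  The greatest monomials of \<open>f X\<^sub>j\<close> and \<open>h f\<close> agree, and greatest monomials add up, so \<open>h\<close> has greatest
  monomial \<open>X\<^sub>j\<close>. The same holds for least monomials, and therefore \<open>h\<close> has no other monomial.
\<close>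

lemma normal_skew:
  assumes f: "f \<in> carrier A" "f \<noteq> \<zero>" and h: "h \<in> carrier A" and j: "j \<in> {1..n}"
    and eq: "f \<otimes> X j = h \<otimes> f"
  shows "\<exists>c. f \<otimes> X j = q_const n q c \<otimes> (X j \<otimes> f)"
proof -
  have "h \<noteq> \<zero>"
  proof
    assume "h = \<zero>"
    then have "f \<otimes> X j = \<zero>" using f(1) unfolding eq by simp
    then show False using mult_nonzero [OF f X_closed X_nonzero, OF j j] by simp
  qed
  note h = h this
  have "lead h + lead f = {#j#} + lead f"
    using lead_mult [OF h f] lead_mult [OF f X_closed X_nonzero, OF j j]
    unfolding eq lead_trail_X(1) [OF j] by (simp only: add.commute)
  then have lead: "lead h = {#j#}" by (rule add_right_imp_eq)
  have "trail h + trail f = {#j#} + trail f"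
    using trail_mult [OF h f] trail_mult [OF f X_closed X_nonzero, OF j j]
    unfolding eq lead_trail_X(2) [OF j] by (simp only: add.commute)
  then have trail: "trail h = {#j#}" by (rule add_right_imp_eq)
  have only: "M = {#j#}" if "coord h M \<noteq> 0" for M
    using lead_ge [OF h that] trail_le [OF h that] unfolding lead trail by (rule order.antisym)
  have "coord h M = coord (q_const n q (coord h {#j#}) \<otimes> X j) M" for M
  proof (cases "M = {#j#}")
    case False
    then have "coord h M = 0" using only by blast
    then show ?thesis using False j by (simp add: coord_scal coord_X)
  qed (use j in \<open>simp add: coord_scal coord_X\<close>)
  then have "coord h = coord (q_const n q (coord h {#j#}) \<otimes> X j)" by (rule ext)
  moreover have "q_const n q (coord h {#j#}) \<otimes> X j \<in> carrier A" using j by simp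
  ultimately have "h = q_const n q (coord h {#j#}) \<otimes> X j"
    by (intro coord_inject [OF h(1)])
  then obtain d where d: "h = q_const n q d \<otimes> X j" by blast
  have "f \<otimes> X j = q_const n q d \<otimes> (X j \<otimes> f)"
    unfolding eq d using f j by (simp add: m_assoc)
  then show ?thesis ..
qed

text \<open>
  The two products \<open>X\<^sup>M X\<^sub>j\<close> and \<open>X\<^sub>j X\<^sup>M\<close> are multiples of the same ordered monomial; the ratio of the
  coefficients is the scalar with which \<open>X\<^sup>M\<close> and \<open>X\<^sub>j\<close> commute.
\<close>

lemma twist_swap:
  assumes "set_mset M \<subseteq> {1..n}" "j \<in> {1..n}"
  shows "twist q M {#j#} = (\<Prod>k\<in>#M. q k j) * twist q {#j#} M"
  using assms(1)
proof (induction M)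
  case (add k M)
  have k: "k \<in> {1..n}" using add by simp
  have "twist q {#k#} {#j#} = q k j * twist q {#j#} {#k#}"
    using q_swap [OF k assms(2)] q_diag [OF k] by (cases k j rule: linorder_cases) (auto simp: twist_def)
  then show ?case
    using add twist_add_left [of q "{#k#}" M "{#j#}"] twist_add_right [of q "{#j#}" "{#k#}" M] by simp
qed simp

text \<open>
  Both sides of the commutation rule have the same monomials, so it can be compared monomial by monomial.
\<close>

lemma skew_support:
  assumes f: "f \<in> carrier A" and j: "j \<in> {1..n}" and eq: "f \<otimes> X j = q_const n q c \<otimes> (X j \<otimes> f)"
    and M: "coord f M \<noteq> 0"
  shows "(\<Prod>k\<in>#M. q k j) = c"
proof -
  have sub: "set_mset M \<subseteq> {1..n}" using coord_support [OF f M] .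
  have "twist q M {#j#} * coord f M = c * (twist q {#j#} M * coord f M)"
    using arg_cong [OF eq, of "\<lambda>x. coord x (add_mset j M)"] f j
    by (simp add: coord_scal coord_mult_X coord_X_mult)
  then show ?thesis
    using M twist_nonzero [of "{#j#}" M] sub j by (simp add: twist_swap [OF sub j])
qed

lemma Lambda_count:
  assumes "set_mset M \<subseteq> {1..n}" "a \<notin># M" "\<And>j. j \<in> {1..n} \<Longrightarrow> (\<Prod>k\<in>#M. q k j) = q a j"
  shows "count M \<in> Lambda n q a"
proof -
  have "(\<Prod>k\<in>{1..n}. q k j ^ count M k) = (\<Prod>k\<in>#M. q k j)" for j
    unfolding image_prod_mset_multiplicity
    by (rule prod.mono_neutral_right) (use assms(1) in \<open>auto simp: count_eq_zero_iff [symmetric] simp del: count_eq_zero_iff\<close>)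
  moreover have "count M k = 0" if "k \<notin> {1..n} \<or> k = a" for k
    using assms(1,2) that by (auto simp only: count_eq_zero_iff)
  ultimately show ?thesis
    using assms(3) by (auto simp only: Lambda_def mem_Collect_eq)
qed

text \<open>
  Dividing each monomial of \<open>f\<close> by \<open>X\<^sub>a\<close> prescribes the coordinates of the quotient.
\<close>

lemma X_divides:
  assumes a: "a \<in> {1..n}" and f: "f \<in> carrier A" and supp: "\<And>M. coord f M \<noteq> 0 \<Longrightarrow> a \<in># M"
  obtains z where "z \<in> carrier A" "f = X a \<otimes> z"
proof -
  define F where "F M = coord f (add_mset a M) / twist q {#a#} M" for M
  have "{M. F M \<noteq> 0} \<subseteq> (\<lambda>M. M - {#a#}) ` {M. coord f M \<noteq> 0}"
  proof
    fix M assume "M \<in> {M. F M \<noteq> 0}"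
    then show "M \<in> (\<lambda>M. M - {#a#}) ` {M. coord f M \<noteq> 0}"
      by (intro image_eqI [of _ _ "add_mset a M"]) (auto simp: F_def)
  qed
  then have "finite {M. F M \<noteq> 0}" using coord_finite [OF f] by (rule finite_surj [rotated])
  moreover have supp_F: "set_mset M \<subseteq> {1..n}" if "F M \<noteq> 0" for M
    using coord_support [OF f, of "add_mset a M"] that by (auto simp: F_def)
  ultimately obtain z where z: "z \<in> carrier A" "coord z = F" by (rule coord_surj)
  have "coord f M = coord (X a \<otimes> z) M" for M
  proof (cases "a \<in># M")
    case True
    then obtain N where N: "M = add_mset a N" by (metis insert_DiffM)
    show ?thesis
    proof (cases "set_mset N \<subseteq> {1..n}")
      case True
      then show ?thesis
        using z a twist_nonzero [of "{#a#}" N] by (simp add: N coord_X_mult F_def)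
    next
      case False
      then have "coord f M = 0" "F N = 0"
        using coord_support [OF f, of M] supp_F [of N] by (auto simp: N)
      then show ?thesis using z a by (simp add: N coord_X_mult)
    qed
  next
    case False
    then have "coord f M = 0" using supp by blast
    moreover have "coord (X a \<otimes> z) M = 0"
    proof (rule ccontr)
      assume "coord (X a \<otimes> z) M \<noteq> 0"
      then obtain K N where KN: "M = K + N" "coord (X a) K \<noteq> 0"
        using coord_mult_split [OF X_closed [OF a] z(1)] by blast
      then show False using False coord_X_support [OF a KN(2)] by simp
    qed
    ultimately show ?thesis by simp
  qed
  then have "f = X a \<otimes> z" using f z a by (intro coord_inject) auto
  then show thesis using that z by blast
qed

text \<open>
  Otherwise the coordinate of \<open>\<psi>(x)\<close> at \<open>X\<^sub>a\<close> would vanish for all \<open>x\<close>: if it vanishes for \<open>x\<close> and \<open>y\<close>,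
  it vanishes for \<open>x y\<close>, because \<open>X\<^sub>a\<close> factors only as \<open>1 \<cdot> X\<^sub>a\<close> and \<open>X\<^sub>a \<cdot> 1\<close>. But \<open>X\<^sub>a\<close> is a value of \<open>\<psi>\<close>.
\<close>

lemma Aut_linear_part:
  assumes \<psi>: "\<psi> \<in> q_Aut n q" and a: "a \<in> {1..n}"
  shows "\<exists>i\<in>{1..n}. coord (\<psi> (X i)) {#a#} \<noteq> 0"
proof (rule ccontr)
  assume "\<not> ?thesis"
  then have zero: "coord (\<psi> (X i)) {#a#} = 0" if "i \<in> {1..n}" for i
    using that by blast
  have hom: "alg_end \<psi>" using \<psi> by (rule Aut_alg_end)
  have "coord (\<psi> x) {#a#} = 0" if "x \<in> carrier A" for x
    using that
  proof (induction x rule: q_space_induct)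
    case (const c)
    then show ?case by (simp add: alg_end_const [OF hom] coord_const)
  next
    case (mult x y)
    show ?case
    proof (rule ccontr)
      assume "coord (\<psi> (x \<otimes> y)) {#a#} \<noteq> 0"
      then have "coord (\<psi> x \<otimes> \<psi> y) {#a#} \<noteq> 0"
        using mult by (simp add: alg_end_mult [OF hom])
      then obtain M N where "{#a#} = M + N" "coord (\<psi> x) M \<noteq> 0" "coord (\<psi> y) N \<noteq> 0"
        using coord_mult_split [OF alg_end_closed [OF hom] alg_end_closed [OF hom]] mult(1,2) by blast
      then show False using mult by (auto simp: single_is_union)
    qed
  qed (simp_all add: zero alg_end_add [OF hom] alg_end_closed [OF hom] coord_add)
  moreover obtain x where "x \<in> carrier A" "\<psi> x = X a"
    using \<psi> X_closed [OF a] unfolding Aut_iff bij_betw_def by (metis imageE)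
  ultimately show False using coord_X [OF a, of "{#a#}"] by force
qed

text \<open>
  For the inverse \<open>\<psi>\<close> choose \<open>i\<close> such that \<open>X\<^sub>a\<close> occurs in \<open>\<psi>(X\<^sub>i)\<close>. Then \<open>X\<^sub>a\<close> divides \<open>\<psi>(X\<^sub>i)\<close>, since \<open>\<Lambda>\<^sub>a\<close>
  is empty, and so \<open>\<phi>(X\<^sub>a)\<close> divides \<open>X\<^sub>i\<close>.
\<close>

lemma Aut_monomial:
  assumes \<Lambda>: "\<forall>i\<in>{1..n}. Lambda n q i = {}" and \<phi>: "\<phi> \<in> q_Aut n q" and a: "a \<in> {1..n}"
  obtains i c where "i \<in> {1..n}" "c \<noteq> 0" "\<phi> (X a) = q_const n q c \<otimes> X i"
proof -
  obtain \<psi> where \<psi>: "\<psi> \<in> q_Aut n q" and \<psi>\<phi>: "\<And>x. x \<in> carrier A \<Longrightarrow> \<psi> (\<phi> x) = x"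
    and \<phi>\<psi>: "\<And>x. x \<in> carrier A \<Longrightarrow> \<phi> (\<psi> x) = x"
    using Aut_inverse [OF \<phi>] by blast
  note hom = Aut_alg_end [OF \<phi>] Aut_alg_end [OF \<psi>]
  obtain i where i: "i \<in> {1..n}" and lin: "coord (\<psi> (X i)) {#a#} \<noteq> 0"
    using Aut_linear_part [OF \<psi> a] by blast
  define f where "f = \<psi> (X i)"
  have "f \<noteq> \<zero>" using lin coord_zero unfolding f_def by metis
  moreover have "f \<in> carrier A" using i alg_end_closed [OF hom(2)] by (simp add: f_def)
  ultimately have f: "f \<in> carrier A" "f \<noteq> \<zero>" by simp_all
  have skew: "\<exists>c. f \<otimes> X j = q_const n q c \<otimes> (X j \<otimes> f)" if j: "j \<in> {1..n}" for j
  proof -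
    have g: "\<phi> (X j) \<in> carrier A" using j alg_end_closed [OF hom(1)] by simp
    then obtain y where y: "y \<in> carrier A" "X i \<otimes> \<phi> (X j) = y \<otimes> X i"
      using X_normal [OF i] by blast
    have "f \<otimes> X j = \<psi> (X i \<otimes> \<phi> (X j))"
      using g i j by (simp add: alg_end_mult [OF hom(2)] \<psi>\<phi> f_def)
    also have "\<dots> = \<psi> y \<otimes> f"
      using y i by (simp add: alg_end_mult [OF hom(2)] f_def)
    finally show ?thesis
      using normal_skew [OF f _ j] y alg_end_closed [OF hom(2)] by blast
  qed
  have "a \<in># M" if M: "coord f M \<noteq> 0" for M
  proof (rule ccontr)
    assume "a \<notin># M"
    moreover have "(\<Prod>k\<in>#M. q k j) = q a j" if j: "j \<in> {1..n}" for j
    proof -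
      obtain c where c: "f \<otimes> X j = q_const n q c \<otimes> (X j \<otimes> f)" using skew [OF j] by blast
      show ?thesis
        using skew_support [OF f(1) j c M] skew_support [OF f(1) j c lin [folded f_def]] by simp
    qed
    ultimately have "count M \<in> Lambda n q a"
      using coord_support [OF f(1) M] by (intro Lambda_count)
    then show False using \<Lambda> a by blast
  qed
  then obtain z where z: "z \<in> carrier A" "f = X a \<otimes> z"
    using X_divides [OF a f(1)] by blast
  define g u where "g = \<phi> (X a)" and "u = \<phi> z"
  have gu: "g \<in> carrier A" "u \<in> carrier A" 
    using z(1) a alg_end_closed [OF hom(1)] by (simp_all add: g_def u_def)
  have Xi: "X i = g \<otimes> u"
    using \<phi>\<psi> [OF X_closed [OF i]] alg_end_mult [OF hom(1) X_closed [OF a] z(1)]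
    unfolding f_def [symmetric] z(2) g_def u_def by simp
  have nz: "g \<noteq> \<zero>" "u \<noteq> \<zero>"
    using X_nonzero [OF i] gu l_null r_null unfolding Xi by metis+
  \<comment> \<open>A constant \<open>\<phi>(X\<^sub>a)\<close> would make \<open>X\<^sub>a\<close> constant.\<close>
  have "lead g \<noteq> {#}"
  proof
    assume "lead g = {#}"
    then obtain c where "g = q_const n q c" using lead_empty_const [OF gu(1) nz(1)] by blast
    then have "X a = q_const n q c"
      using \<psi>\<phi> [of "X a"] a alg_end_const [OF hom(2)] by (simp add: g_def)
    then show False using coord_X [OF a, of "{#a#}"] coord_const [of c "{#a#}"] by simp
  qed
  \<comment> \<open>The multiset with the single element \<open>i\<close> splits only trivially; as \<open>g\<close> is not constant, \<open>u\<close> is.\<close>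
  moreover have "lead g + lead u = {#i#}"
    using lead_mult [OF gu(1) nz(1) gu(2) nz(2)] lead_trail_X [OF i] Xi by simp
  ultimately have "lead u = {#}" by (auto simp: union_is_single)
  then obtain c where u: "u = q_const n q c" using lead_empty_const [OF gu(2) nz(2)] by blast
  then have "c \<noteq> 0" using nz(2) scal_zero by metis
  moreover have "X i = q_const n q c \<otimes> g"
    using Xi u scal_central [OF gu(1), of c] by simp
  then have "g = q_const n q (inverse c) \<otimes> X i"
    using gu(1) \<open>c \<noteq> 0\<close> by (simp add: scal_scal)
  ultimately show thesis using that [of i "inverse c"] i by (simp add: g_def)
qed

text \<open>
  The index map is injective because \<open>\<phi>\<close> is, and it is a symmetry of the matrix because \<open>\<phi>\<close> preserves
  the relations while products of variables are nonzero.
\<close>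

lemma Aut_permutation:
  assumes \<Lambda>: "\<forall>i\<in>{1..n}. Lambda n q i = {}" and \<phi>: "\<phi> \<in> q_Aut n q"
  obtains \<sigma> c where "\<sigma> permutes {1..n}" "\<forall>i\<in>{1..n}. \<forall>j\<in>{1..n}. q (\<sigma> i) (\<sigma> j) = q i j"
    "\<forall>i\<in>{1..n}. c i \<noteq> 0 \<and> \<phi> (X i) = q_const n q (c i) \<otimes> X (\<sigma> i)"
proof -
  have "\<forall>a\<in>{1..n}. \<exists>p. fst p \<in> {1..n} \<and> snd p \<noteq> 0 \<and> \<phi> (X a) = q_const n q (snd p) \<otimes> X (fst p)"
  proof
    fix a assume "a \<in> {1..n}"
    then obtain i c where "i \<in> {1..n}" "c \<noteq> 0" "\<phi> (X a) = q_const n q c \<otimes> X i"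
      using Aut_monomial [OF \<Lambda> \<phi>] by blast
    then show "\<exists>p. fst p \<in> {1..n} \<and> snd p \<noteq> 0 \<and> \<phi> (X a) = q_const n q (snd p) \<otimes> X (fst p)"
      by (intro exI [of _ "(i, c)"]) simp
  qed
  from bchoice [OF this] obtain p where
    p: "\<forall>a\<in>{1..n}. fst (p a) \<in> {1..n} \<and> snd (p a) \<noteq> 0 \<and>
      \<phi> (X a) = q_const n q (snd (p a)) \<otimes> X (fst (p a))" ..
  define c where "c a = snd (p a)" for a
  define \<sigma> where "\<sigma> a = (if a \<in> {1..n} then fst (p a) else a)" for a
  have \<sigma>: "\<sigma> a \<in> {1..n}" "c a \<noteq> 0" "\<phi> (X a) = q_const n q (c a) \<otimes> X (\<sigma> a)" if "a \<in> {1..n}" for a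
    using bspec [OF p that] that by (simp_all add: \<sigma>_def c_def)
  note hom = Aut_alg_end [OF \<phi>]
  have inj: "inj_on \<phi> (carrier A)" using \<phi> by (auto simp: Aut_iff bij_betw_def)
  have "inj_on \<sigma> {1..n}"
  proof (rule inj_onI)
    fix a b assume ab: "a \<in> {1..n}" "b \<in> {1..n}" "\<sigma> a = \<sigma> b"
    have "\<phi> (q_const n q d \<otimes> X i) = q_const n q (d * c i) \<otimes> X (\<sigma> i)" if i: "i \<in> {1..n}" for d i
    proof -
      have "\<phi> (q_const n q d \<otimes> X i) = q_const n q d \<otimes> (q_const n q (c i) \<otimes> X (\<sigma> i))"
        using alg_end_mult [OF hom scal_closed X_closed [OF i]]
        unfolding alg_end_const [OF hom] \<sigma>(3) [OF i] .
      then show ?thesis unfolding scal_scal [OF X_closed [OF \<sigma>(1) [OF i]]] .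
    qed
    from this [OF ab(1), of "c b"] this [OF ab(2), of "c a"]
    have "\<phi> (q_const n q (c b) \<otimes> X a) = \<phi> (q_const n q (c a) \<otimes> X b)"
      unfolding ab(3) mult.commute [of "c a" "c b"] by (rule trans [OF _ sym])
    then have "q_const n q (c b) \<otimes> X a = q_const n q (c a) \<otimes> X b"
      by (rule inj_onD [OF inj]) (use ab in simp_all)
    then have "coord (q_const n q (c b) \<otimes> X a) {#a#} = coord (q_const n q (c a) \<otimes> X b) {#a#}"
      by (rule arg_cong)
    then have "c b * coord (X a) {#a#} = c a * coord (X b) {#a#}"
      using ab by (simp only: coord_scal X_closed)
    then have "coord (X b) {#a#} \<noteq> 0" using \<sigma>(2) [OF ab(2)] ab(1) by (auto simp: coord_X)
    from coord_X_support [OF ab(2) this] show "a = b" by simp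
  qed
  moreover have "\<sigma> ` {1..n} = {1..n}"
    using \<sigma>(1) \<open>inj_on \<sigma> {1..n}\<close> by (intro endo_inj_surj) blast+
  moreover have "\<sigma> a = a" if "a \<notin> {1..n}" for a using that by (simp only: \<sigma>_def if_False)
  ultimately have perm: "\<sigma> permutes {1..n}" by (intro bij_imp_permutes bij_betw_imageI)
  have "q (\<sigma> i) (\<sigma> j) = q i j" if ij: "i \<in> {1..n}" "j \<in> {1..n}" for i j
  proof -
    let ?y = "X (\<sigma> j) \<otimes> X (\<sigma> i)"
    have closed: "X (\<sigma> i) \<in> carrier A" "X (\<sigma> j) \<in> carrier A" using \<sigma>(1) ij by simp_all
    have "\<phi> (X i \<otimes> X j) = q_const n q (c i * c j) \<otimes> (X (\<sigma> i) \<otimes> X (\<sigma> j))"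
      using ij closed by (simp add: alg_end_mult [OF hom] \<sigma>(3) scal_prod)
    also have "\<dots> = q_const n q (c i * c j * q (\<sigma> i) (\<sigma> j)) \<otimes> ?y"
      unfolding X_commute [OF \<sigma>(1) [OF ij(1)] \<sigma>(1) [OF ij(2)]] using closed by (simp add: scal_scal)
    finally have eq1: "\<phi> (X i \<otimes> X j) = q_const n q (c i * c j * q (\<sigma> i) (\<sigma> j)) \<otimes> ?y" .
    have eq2: "\<phi> (X i \<otimes> X j) = q_const n q (q i j * (c j * c i)) \<otimes> ?y"
      unfolding X_commute [OF ij] using ij closed
      by (simp add: alg_end_mult [OF hom] alg_end_const [OF hom] \<sigma>(3) scal_prod scal_scal)
    have "?y \<in> carrier A" "?y \<noteq> \<zero>"
      using closed X_nonzero [OF \<sigma>(1)] ij by (simp_all add: mult_nonzero)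
    then have "c i * c j * q (\<sigma> i) (\<sigma> j) = q i j * (c j * c i)"
      by (rule scal_inject [OF trans [OF eq1 [symmetric] eq2]])
    then show ?thesis using \<sigma>(2) ij by simp
  qed
  then show thesis using that [of \<sigma> c] perm \<sigma>(2,3) by blast
qed

theorem Aut_eq_torus_iff:
  "q_Aut n q = q_torus n q \<longleftrightarrow>
     (\<forall>i\<in>{1..n}. Lambda n q i = {}) \<and>
     \<not> (\<exists>\<sigma>. \<sigma> permutes {1..n} \<and> \<sigma> \<noteq> id \<and> (\<forall>i\<in>{1..n}. \<forall>j\<in>{1..n}. q (\<sigma> i) (\<sigma> j) = q i j))"
    (is "_ \<longleftrightarrow> ?\<Lambda> \<and> \<not> ?sym")
proof (intro iffI conjI)
  assume eq: "q_Aut n q = q_torus n q"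
  have toric: "\<exists>t. \<phi> (X i) = q_const n q t \<otimes> X i" if "\<phi> \<in> q_Aut n q" "i \<in> {1..n}" for \<phi> i
  proof -
    have "\<phi> \<in> q_torus n q" using that(1) unfolding eq .
    then show ?thesis using that(2) unfolding q_torus_def q_scale_const A_eq [symmetric] by blast
  qed
  show ?\<Lambda>
  proof (intro ballI equals0I)
    fix i \<nu> assume i: "i \<in> {1..n}" and \<nu>: "\<nu> \<in> Lambda n q i"
    let ?m = "q_monom n q \<nu>"
    note m = monom_closed [of \<nu>] monom_nonzero [of \<nu>]
    obtain \<phi> where \<phi>: "\<phi> \<in> q_Aut n q" "\<phi> (X i) = X i \<oplus> ?m" "\<phi> ?m = ?m"
      using shear_Aut [OF i \<nu>] by blast
    obtain t where t: "X i \<oplus> ?m = q_const n q t \<otimes> X i"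
      using toric [OF \<phi>(1) i] unfolding \<phi>(2) by blast
    \<comment> \<open>If the shear were scalar, \<open>X\<^sup>\<nu>\<close> would equal \<open>(t - 1) X\<^sub>i\<close>; applying the shear, which fixes \<open>X\<^sup>\<nu>\<close>, gives \<open>(t - 1) X\<^sup>\<nu> = 0\<close>.\<close>
    have coord_m: "coord ?m M = (t - 1) * coord (X i) M" for M
      using arg_cong [OF t, of "\<lambda>x. coord x M"] i m by (simp add: coord_add coord_scal algebra_simps)
    have m_eq: "?m = q_const n q (t - 1) \<otimes> X i"
      by (rule coord_inject) (use i m in \<open>simp_all add: fun_eq_iff coord_scal coord_m\<close>)
    have "\<phi> (q_const n q (t - 1) \<otimes> X i) = q_const n q (t - 1) \<otimes> (X i \<oplus> ?m)"
      using alg_end_mult [OF Aut_alg_end [OF \<phi>(1)] scal_closed X_closed [OF i]]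
      unfolding alg_end_const [OF Aut_alg_end [OF \<phi>(1)]] \<phi>(2) .
    then have fixed: "q_const n q (t - 1) \<otimes> (X i \<oplus> ?m) = ?m"
      unfolding m_eq [symmetric] \<phi>(3) by (rule sym)
    have fixed_coord: "(t - 1) * (coord (X i) M + coord ?m M) = coord ?m M" for M
      using arg_cong [OF fixed, of "\<lambda>x. coord x M"] i m by (simp add: coord_scal coord_add)
    have "(t - 1) * coord ?m M = 0" for M
      using fixed_coord [of M] coord_m [of M] by (simp add: distrib_left)
    then have "coord ?m M = 0" for M
      using coord_m [of M] by (cases "t = 1") simp_all
    then show False using coord_nonzero [OF m] by simp
  qed
  show "\<not> ?sym"
  proof
    assume ?sym
    then obtain \<sigma> where \<sigma>: "\<sigma> permutes {1..n}" "\<sigma> \<noteq> id"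
      "\<And>i j. i \<in> {1..n} \<Longrightarrow> j \<in> {1..n} \<Longrightarrow> q (\<sigma> i) (\<sigma> j) = q i j" by blast
    obtain i where moved: "\<sigma> i \<noteq> i" using \<sigma>(2) by (auto simp: fun_eq_iff)
    then have i: "i \<in> {1..n}" "\<sigma> i \<noteq> i" using permutes_not_in [OF \<sigma>(1)] by blast+
    have \<sigma>i: "\<sigma> i \<in> {1..n}" using i(1) by (simp only: permutes_in_image [OF \<sigma>(1)])
    obtain \<phi> where \<phi>: "\<phi> \<in> q_Aut n q" "\<phi> (X i) = X (\<sigma> i)"
      using permutation_Aut [OF \<sigma>(1,3)] i(1) by blast
    obtain t where t: "X (\<sigma> i) = q_const n q t \<otimes> X i"
      using toric [OF \<phi>(1) i(1)] unfolding \<phi>(2) by blast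
    have "coord (X (\<sigma> i)) {#\<sigma> i#} = t * coord (X i) {#\<sigma> i#}"
      unfolding t coord_scal [OF X_closed [OF i(1)]] ..
    then show False using i \<sigma>i by (simp add: coord_X)
  qed
next
  assume *: "?\<Lambda> \<and> \<not> ?sym"
  show "q_Aut n q = q_torus n q"
  proof
    show "q_torus n q \<subseteq> q_Aut n q" by (auto simp: q_torus_def)
    show "q_Aut n q \<subseteq> q_torus n q"
    proof
      fix \<phi> assume \<phi>: "\<phi> \<in> q_Aut n q"
      have \<Lambda>: ?\<Lambda> using * by (rule conjunct1)
      obtain \<sigma> c where \<sigma>: "\<sigma> permutes {1..n}" "\<forall>i\<in>{1..n}. \<forall>j\<in>{1..n}. q (\<sigma> i) (\<sigma> j) = q i j"
        "\<forall>i\<in>{1..n}. c i \<noteq> 0 \<and> \<phi> (X i) = q_const n q (c i) \<otimes> X (\<sigma> i)"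
        using Aut_permutation [OF \<Lambda> \<phi>] .
      then have "\<sigma> = id" using * by blast
      then have "\<forall>i\<in>{1..n}. c i \<noteq> 0 \<and> \<phi> (X i) = q_const n q (c i) \<otimes> X i"
        using \<sigma>(3) by simp
      then show "\<phi> \<in> q_torus n q"
        using \<phi> unfolding q_torus_def q_scale_const A_eq [symmetric] by blast
    qed
  qed
qed

end

section \<open>The exceptional pair of commuting variables\<close>

lemma mat_commute_perm_matrix:
  fixes q :: "nat \<Rightarrow> nat \<Rightarrow> 'a::field"
  assumes I: "finite I" and \<sigma>: "\<sigma> permutes I"
  shows "mat_commute_on I q (perm_matrix \<sigma>) \<longleftrightarrow> (\<forall>i\<in>I. \<forall>j\<in>I. q (\<sigma> i) (\<sigma> j) = q i j)"
proof -
  have right: "mat_mult_on I q (perm_matrix \<sigma>) i j = q i (\<sigma> j)" if "j \<in> I" for i j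
  proof -
    have "(\<Sum>k\<in>I. q i k * perm_matrix \<sigma> k j) = (\<Sum>k\<in>I. if k = \<sigma> j then q i (\<sigma> j) else 0)"
      by (rule sum.cong) (auto simp: perm_matrix_def)
    then show ?thesis using I that permutes_in_image [OF \<sigma>, of j] by (simp add: mat_mult_on_def)
  qed
  have left: "mat_mult_on I (perm_matrix \<sigma>) q (\<sigma> i) j = q i j" if "i \<in> I" for i j
  proof -
    have "(\<Sum>k\<in>I. perm_matrix \<sigma> (\<sigma> i) k * q k j) = (\<Sum>k\<in>I. if k = i then q i j else 0)"
      by (rule sum.cong) (auto simp: perm_matrix_def inj_eq [OF permutes_inj [OF \<sigma>]])
    then show ?thesis using I that by (simp add: mat_mult_on_def)
  qed
  have "mat_commute_on I q (perm_matrix \<sigma>) \<longleftrightarrow>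
      (\<forall>i\<in>\<sigma> ` I. \<forall>j\<in>I. mat_mult_on I q (perm_matrix \<sigma>) i j = mat_mult_on I (perm_matrix \<sigma>) q i j)"
    unfolding mat_commute_on_def permutes_image [OF \<sigma>] ..
  then show ?thesis by (simp add: left right)
qed

context quantum_space
begin

text \<open>
  A symmetry maps the only pair of commuting variables to itself and hence preserves its complement.
  Emptiness of \<open>\<Lambda>\<^bsub>i'\<^esub>\<close> excludes the symmetry that exchanges \<open>i'\<close> and \<open>j'\<close> and fixes all other indices.
\<close>

lemma symmetry_of_pair_iff:
  assumes \<Lambda>: "\<forall>i\<in>{1..n}. Lambda n q i = {}" and unit: "unit_entries n q = {(i', j')}"
  shows "(\<exists>\<sigma>. \<sigma> permutes {1..n} \<and> \<sigma> \<noteq> id \<and> (\<forall>i\<in>{1..n}. \<forall>j\<in>{1..n}. q (\<sigma> i) (\<sigma> j) = q i j)) \<longleftrightarrow>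
    (\<exists>\<pi>\<^sub>1 \<pi>\<^sub>2. \<pi>\<^sub>1 permutes {i', j'} \<and> \<pi>\<^sub>2 permutes ({1..n} - {i', j'}) \<and> \<pi>\<^sub>2 \<noteq> id \<and>
       (\<forall>r\<in>{1..n} - {i', j'}. q i' r = q (\<pi>\<^sub>1 i') (\<pi>\<^sub>2 r) \<and> q j' r = q (\<pi>\<^sub>1 j') (\<pi>\<^sub>2 r)) \<and>
       mat_commute_on ({1..n} - {i', j'}) q (perm_matrix \<pi>\<^sub>2))"
    (is "?sym \<longleftrightarrow> ?pair")
proof -
  let ?P = "{i', j'}" and ?J = "{1..n} - {i', j'}"
  have finite_J: "finite ?J" by simp
  have "(i', j') \<in> unit_entries n q" using unit by simp
  then have ij: "i' < j'" "i' \<in> {1..n}" "j' \<in> {1..n}" "q i' j' = 1"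
    by (simp_all add: unit_entries_def)
  have ji: "q j' i' = 1" using q_inverse [OF ij(2,3)] ij(4) by simp
  have P_unit: "q i j = 1" if "i \<in> ?P" "j \<in> ?P" for i j
    using that ij ji q_diag by auto
  have unit_P: "{i, j} = ?P" if "i \<in> {1..n}" "j \<in> {1..n}" "i \<noteq> j" "q i j = 1" for i j
  proof -
    have "q j i = 1" using q_inverse [OF that(1,2)] that(4) by simp
    then have "(i, j) \<in> unit_entries n q \<or> (j, i) \<in> unit_entries n q"
      using that by (auto simp: unit_entries_def)
    then show ?thesis using unit by auto
  qed
  show ?thesis
  proof
    assume ?sym
    then obtain \<sigma> where \<sigma>: "\<sigma> permutes {1..n}" "\<sigma> \<noteq> id"
      and sym: "\<And>i j. i \<in> {1..n} \<Longrightarrow> j \<in> {1..n} \<Longrightarrow> q (\<sigma> i) (\<sigma> j) = q i j" by blast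
    have range: "\<sigma> x \<in> {1..n}" if "x \<in> {1..n}" for x
      using that by (simp only: permutes_in_image [OF \<sigma>(1)])
    have inj: "\<sigma> x = \<sigma> y \<longleftrightarrow> x = y" for x y
      using permutes_inj [OF \<sigma>(1)] by (simp add: inj_eq)
    \<comment> \<open>The images of \<open>i'\<close> and \<open>j'\<close> commute as well, and there is only one such pair.\<close>
    have \<sigma>P: "\<sigma> ` ?P = ?P"
      using unit_P [OF range range, OF ij(2,3)] ij sym [OF ij(2,3)] by (simp add: inj)
    have \<sigma>J: "\<sigma> ` ?J = ?J"
      using permutes_image [OF \<sigma>(1)] \<sigma>P image_set_diff [OF permutes_inj [OF \<sigma>(1)]] by metis
    define \<pi>\<^sub>1 where "\<pi>\<^sub>1 x = (if x \<in> ?P then \<sigma> x else x)" for x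
    define \<pi>\<^sub>2 where "\<pi>\<^sub>2 x = (if x \<in> ?J then \<sigma> x else x)" for x
    have bij: "bij_betw \<sigma> B B" if "\<sigma> ` B = B" for B
      using that permutes_inj [OF \<sigma>(1)] by (auto simp: bij_betw_def intro: inj_on_subset)
    have "bij_betw \<pi>\<^sub>1 ?P ?P"
      using bij [OF \<sigma>P] by (rule bij_betw_cong [THEN iffD1, rotated]) (simp add: \<pi>\<^sub>1_def)
    then have \<pi>\<^sub>1: "\<pi>\<^sub>1 permutes ?P" by (rule bij_imp_permutes) (simp add: \<pi>\<^sub>1_def)
    have "bij_betw \<pi>\<^sub>2 ?J ?J"
      using bij [OF \<sigma>J] by (rule bij_betw_cong [THEN iffD1, rotated]) (simp only: \<pi>\<^sub>2_def if_True)
    then have \<pi>\<^sub>2: "\<pi>\<^sub>2 permutes ?J" by (rule bij_imp_permutes) (simp only: \<pi>\<^sub>2_def if_False)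
    have "\<pi>\<^sub>2 \<noteq> id"
    proof
      assume id: "\<pi>\<^sub>2 = id"
      have fixed: "\<sigma> r = r" if "r \<notin> ?P" for r
      proof (cases "r \<in> {1..n}")
        case True
        then show ?thesis using that fun_cong [OF id, of r] by (simp add: \<pi>\<^sub>2_def)
      next
        case False
        then show ?thesis by (rule permutes_not_in [OF \<sigma>(1)])
      qed
      have swap: "\<sigma> i' = j'"
      proof (rule ccontr)
        assume "\<sigma> i' \<noteq> j'"
        then have "\<sigma> i' = i'" "\<sigma> j' = j'" using \<sigma>P inj [of i' j'] ij(1) by auto
        then have "\<sigma> x = x" for x using fixed [of x] by (cases "x \<in> ?P") auto
        then show False using \<sigma>(2) by (simp add: fun_eq_iff)
      qed
      \<comment> \<open>Then \<open>X\<^bsub>i'\<^esub>\<close> and \<open>X\<^bsub>j'\<^esub>\<close> obey the same relations, so \<open>X\<^bsub>j'\<^esub>\<close> gives an element of \<open>\<Lambda>\<^bsub>i'\<^esub>\<close>.\<close>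
      have "q j' j = q i' j" if j: "j \<in> {1..n}" for j
      proof (cases "j \<in> ?P")
        case True
        then show ?thesis using P_unit by simp
      next
        case False
        then show ?thesis using sym [OF ij(2) j] fixed [of j] swap by simp
      qed
      then have "count {#j'#} \<in> Lambda n q i'"
        using ij by (intro Lambda_count) auto
      then show False using \<Lambda> ij(2) by blast
    qed
    moreover have "q i' r = q (\<pi>\<^sub>1 i') (\<pi>\<^sub>2 r) \<and> q j' r = q (\<pi>\<^sub>1 j') (\<pi>\<^sub>2 r)" if "r \<in> ?J" for r
      using that ij sym [of i' r] sym [of j' r] by (simp add: \<pi>\<^sub>1_def \<pi>\<^sub>2_def)
    moreover have "q (\<pi>\<^sub>2 i) (\<pi>\<^sub>2 j) = q i j" if "i \<in> ?J" "j \<in> ?J" for i j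
      using that sym [of i j] by (simp add: \<pi>\<^sub>2_def)
    then have "mat_commute_on ?J q (perm_matrix \<pi>\<^sub>2)"
      by (simp only: mat_commute_perm_matrix [OF finite_J \<pi>\<^sub>2]) blast
    ultimately show ?pair using \<pi>\<^sub>1 \<pi>\<^sub>2 by blast
  next
    assume ?pair
    then obtain \<pi>\<^sub>1 \<pi>\<^sub>2 where \<pi>\<^sub>1: "\<pi>\<^sub>1 permutes ?P" and \<pi>\<^sub>2: "\<pi>\<^sub>2 permutes ?J" "\<pi>\<^sub>2 \<noteq> id"
      and mixed: "\<And>r. r \<in> ?J \<Longrightarrow> q i' r = q (\<pi>\<^sub>1 i') (\<pi>\<^sub>2 r) \<and> q j' r = q (\<pi>\<^sub>1 j') (\<pi>\<^sub>2 r)"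
      and commute: "mat_commute_on ?J q (perm_matrix \<pi>\<^sub>2)" by blast
    have rest: "q (\<pi>\<^sub>2 i) (\<pi>\<^sub>2 j) = q i j" if "i \<in> ?J" "j \<in> ?J" for i j
      using commute that unfolding mat_commute_perm_matrix [OF finite_J \<pi>\<^sub>2(1)] by blast
    define \<sigma> where "\<sigma> = \<pi>\<^sub>1 \<circ> \<pi>\<^sub>2"
    have "\<pi>\<^sub>1 permutes {1..n}" using permutes_subset [OF \<pi>\<^sub>1] ij by simp
    moreover have "\<pi>\<^sub>2 permutes {1..n}" using permutes_subset [OF \<pi>\<^sub>2(1)] by blast
    ultimately have \<sigma>: "\<sigma> permutes {1..n}" unfolding \<sigma>_def by (rule permutes_compose [rotated])
    have \<sigma>J: "\<sigma> x = \<pi>\<^sub>2 x" "\<pi>\<^sub>2 x \<in> ?J" if "x \<in> ?J" for x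
    proof -
      show J: "\<pi>\<^sub>2 x \<in> ?J" using that by (simp only: permutes_in_image [OF \<pi>\<^sub>2(1)])
      then show "\<sigma> x = \<pi>\<^sub>2 x" using permutes_not_in [OF \<pi>\<^sub>1, of "\<pi>\<^sub>2 x"] by (simp add: \<sigma>_def)
    qed
    have \<sigma>P: "\<sigma> x = \<pi>\<^sub>1 x" "\<pi>\<^sub>1 x \<in> ?P" if "x \<in> ?P" for x
    proof -
      show "\<pi>\<^sub>1 x \<in> ?P" using that by (simp only: permutes_in_image [OF \<pi>\<^sub>1])
      show "\<sigma> x = \<pi>\<^sub>1 x" using permutes_not_in [OF \<pi>\<^sub>2(1), of x] that by (auto simp: \<sigma>_def)
    qed
    have PJ: "q (\<sigma> x) (\<sigma> r) = q x r" if "x \<in> ?P" "r \<in> ?J" for x r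
      using mixed [OF that(2)] \<sigma>P(1) [OF that(1)] \<sigma>J(1) [OF that(2)] that(1) by auto
    have range: "\<sigma> x \<in> {1..n}" if "x \<in> {1..n}" for x
      using that by (simp only: permutes_in_image [OF \<sigma>])
    have sym: "q (\<sigma> i) (\<sigma> j) = q i j" if i: "i \<in> {1..n}" and j: "j \<in> {1..n}" for i j
    proof -
      consider "i \<in> ?P" "j \<in> ?P" | "i \<in> ?P" "j \<in> ?J" | "i \<in> ?J" "j \<in> ?P" | "i \<in> ?J" "j \<in> ?J"
        using i j by blast
      then show ?thesis
      proof cases
        case 1
        then show ?thesis using P_unit [OF 1] P_unit [OF \<sigma>P(2) \<sigma>P(2), OF 1] \<sigma>P(1) by simp
      next
        case 2
        then show ?thesis by (rule PJ)
      next
        case 3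
        then show ?thesis
          using PJ [OF 3(2,1)] q_inverse [OF j i] q_inverse [OF range range, OF j i] by simp
      next
        case 4
        then show ?thesis using rest [OF 4] \<sigma>J(1) by simp
      qed
    qed
    have "\<sigma> \<noteq> id"
    proof
      assume id: "\<sigma> = id"
      have "\<pi>\<^sub>2 x = x" for x
        using \<sigma>J(1) [of x] permutes_not_in [OF \<pi>\<^sub>2(1), of x] id by (cases "x \<in> ?J") simp_all
      then show False using \<pi>\<^sub>2(2) by (simp add: fun_eq_iff)
    qed
    then show ?sym using \<sigma> sym by blast
  qed
qed

end

theorem theorem1:
  fixes n :: nat and q :: "nat \<Rightarrow> nat \<Rightarrow> 'a::field_char_0"
  assumes "n \<ge> 3"
    and "mult_antisym n q"
    and "card (unit_entries n q) \<le> 1"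
  shows
    "((\<forall>i j. 1 \<le> i \<and> i < j \<and> j \<le> n \<longrightarrow> q i j \<noteq> 1) \<longrightarrow>
        (q_Aut n q = q_torus n q \<longleftrightarrow>
          q_E n q = {q_zero_map n q} \<and>
          \<not> (\<exists>\<sigma>. \<sigma> permutes {1..n} \<and> \<sigma> \<noteq> id \<and> mat_commute_on {1..n} q (perm_matrix \<sigma>))))
     \<and>
     (\<forall>i' j'. unit_entries n q = {(i', j')} \<longrightarrow>
        (q_Aut n q = q_torus n q \<longleftrightarrow>
          q_E n q = {q_zero_map n q} \<and>
          \<not> (\<exists>\<pi>\<^sub>1 \<pi>\<^sub>2. \<pi>\<^sub>1 permutes {i', j'} \<and>
                \<pi>\<^sub>2 permutes ({1..n} - {i', j'}) \<and> \<pi>\<^sub>2 \<noteq> id \<and>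
                (\<forall>r\<in>{1..n} - {i', j'}.
                   q i' r = q (\<pi>\<^sub>1 i') (\<pi>\<^sub>2 r) \<and> q j' r = q (\<pi>\<^sub>1 j') (\<pi>\<^sub>2 r)) \<and>
                mat_commute_on ({1..n} - {i', j'}) q (perm_matrix \<pi>\<^sub>2))))"
proof -
  interpret quantum_space n q "q_space n q"
    by unfold_locales (rule assms(2), rule refl)
  have "q_Aut n q = q_torus n q \<longleftrightarrow> q_E n q = {q_zero_map n q} \<and>
      \<not> (\<exists>\<sigma>. \<sigma> permutes {1..n} \<and> \<sigma> \<noteq> id \<and> mat_commute_on {1..n} q (perm_matrix \<sigma>))"
    unfolding Aut_eq_torus_iff E_zero_iff
    using mat_commute_perm_matrix [OF finite_atLeastAtMost, of _ 1 n q] by blast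
  moreover have "q_Aut n q = q_torus n q \<longleftrightarrow> q_E n q = {q_zero_map n q} \<and>
      \<not> (\<exists>\<pi>\<^sub>1 \<pi>\<^sub>2. \<pi>\<^sub>1 permutes {i', j'} \<and>
            \<pi>\<^sub>2 permutes ({1..n} - {i', j'}) \<and> \<pi>\<^sub>2 \<noteq> id \<and>
            (\<forall>r\<in>{1..n} - {i', j'}.
               q i' r = q (\<pi>\<^sub>1 i') (\<pi>\<^sub>2 r) \<and> q j' r = q (\<pi>\<^sub>1 j') (\<pi>\<^sub>2 r)) \<and>
            mat_commute_on ({1..n} - {i', j'}) q (perm_matrix \<pi>\<^sub>2))"
    if "unit_entries n q = {(i', j')}" for i' j'
    unfolding Aut_eq_torus_iff E_zero_iff
    by (intro conj_cong refl arg_cong [of _ _ Not]) (rule symmetry_of_pair_iff [OF _ that])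
  ultimately show ?thesis by blast
qed

end
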